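(* Let $K$ be a valued field with value group $\Gamma$ and let $T=\mathrm{Th}(K;+,\cdot,|)$. If $\Gamma$ is not divisible, then $T$ is not convexly orderable, hence not VC-minimal. In particular, the theory of the $p$-adics, $\mathrm{Th}(\mathbb{Q}_p;+,\cdot,|)$, is not VC-minimal.
   Context: The valuation is $v:K\to\Gamma\cup\{\infty\}$, and $x\mid y$ is the binary relation on $K$ meaning $v(x)\le v(y)$; $p$ is a prime and $\mathbb{Q}_p$ carries its $p$-adic valuation. $\Gamma$ is divisible if $n\Gamma=\Gamma$ for all $n\ge1$. Directedness: for a set $X$, a family $\mathcal{B}\subseteq\mathcal{P}(X)$ is directed if for all $A,B\in\mathcal{B}$ either $A\subseteq B$, or $B\subseteq A$, or $A\cap B=\emptyset$. For a theory $T$, a set of formulas $\Psi=\{\psi_i(x;\bar y_i) : i\in I\}$ ($x$ a single variable) is directed if for all $\mathfrak{M}\models T$ the family $\{\psi_i(\mathfrak{M};\bar a) : i\in I, \bar a\in M^{|\bar y_i|}\}$ is directed, where $\psi_i(\mathfrak{M};\bar a)=\{b\in M : \mathfrak{M}\models\psi_i(b;\bar a)\}$. VC-minimality: $T$ is VC-minimal if there is a directed $\Psi$ such that every formula $\varphi(x)$ in the single variable $x$, with parameters from a model of $T$, is $T$-equivalent to a boolean combination of instances $\psi(x;\bar a)$ of formulas $\psi\in\Psi$. Convex orderability: a structure $\mathfrak{M}$ is convexly orderable if there is a linear order $\unlhd$ on $M$ (not necessarily definable) such that for every formula $\varphi(x;\bar y)$ ($x$ a single variable) there is $k<\omega$ such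 that for all $\bar b\in M^{|\bar y|}$, $\varphi(\mathfrak{M};\bar b)$ is a union of at most $k$ $\unlhd$-convex subsets of $M$. This property is preserved under elementary equivalence, so a complete theory is called convexly orderable if its models are. *)

theory Defs
  imports Complex_Main "HOL-Computational_Algebra.Primes" "HOL-Library.Extended" "HOL-Algebra.QuotRing"
begin

section \<open>First-order logic in the language \<open>(+, \<cdot>, |)\<close>\<close>

datatype tm = Var nat | Add tm tm | Mul tm tm

datatype fm = Eq tm tm | Divides tm tm | Neg fm | Conj fm fm | Exists nat fm

fun tm_vars :: "tm \<Rightarrow> nat set" where
  "tm_vars (Var n) = {n}"
| "tm_vars (Add s t) = tm_vars s \<union> tm_vars t"
| "tm_vars (Mul s t) = tm_vars s \<union> tm_vars t"

fun free_vars :: "fm \<Rightarrow> nat set" where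
  "free_vars (Eq s t) = tm_vars s \<union> tm_vars t"
| "free_vars (Divides s t) = tm_vars s \<union> tm_vars t"
| "free_vars (Neg \<phi>) = free_vars \<phi>"
| "free_vars (Conj \<phi> \<psi>) = free_vars \<phi> \<union> free_vars \<psi>"
| "free_vars (Exists n \<phi>) = free_vars \<phi> - {n}"

definition sentence :: "fm \<Rightarrow> bool" where
  "sentence \<phi> \<longleftrightarrow> free_vars \<phi> = {}"

record 'm struct =
  univ :: "'m set"
  add_op :: "'m \<Rightarrow> 'm \<Rightarrow> 'm"
  mul_op :: "'m \<Rightarrow> 'm \<Rightarrow> 'm"
  div_rel :: "'m \<Rightarrow> 'm \<Rightarrow> bool"

definition is_struct :: "'m struct \<Rightarrow> bool" where
  "is_struct M \<longleftrightarrow> univ M \<noteq> {} \<and>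
     (\<forall>a\<in>univ M. \<forall>b\<in>univ M. add_op M a b \<in> univ M \<and> mul_op M a b \<in> univ M)"

definition assignments :: "'m struct \<Rightarrow> (nat \<Rightarrow> 'm) set" where
  "assignments M = {e. \<forall>n. e n \<in> univ M}"

fun tm_val :: "'m struct \<Rightarrow> (nat \<Rightarrow> 'm) \<Rightarrow> tm \<Rightarrow> 'm" where
  "tm_val M e (Var n) = e n"
| "tm_val M e (Add s t) = add_op M (tm_val M e s) (tm_val M e t)"
| "tm_val M e (Mul s t) = mul_op M (tm_val M e s) (tm_val M e t)"

fun sat :: "'m struct \<Rightarrow> (nat \<Rightarrow> 'm) \<Rightarrow> fm \<Rightarrow> bool" where
  "sat M e (Eq s t) \<longleftrightarrow> tm_val M e s = tm_val M e t"
| "sat M e (Divides s t) \<longleftrightarrow> div_rel M (tm_val M e s) (tm_val M e t)"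
| "sat M e (Neg \<phi>) \<longleftrightarrow> \<not> sat M e \<phi>"
| "sat M e (Conj \<phi> \<psi>) \<longleftrightarrow> sat M e \<phi> \<and> sat M e \<psi>"
| "sat M e (Exists n \<phi>) \<longleftrightarrow> (\<exists>b\<in>univ M. sat M (e(n := b)) \<phi>)"

definition Th :: "'m struct \<Rightarrow> fm set" where
  "Th M = {\<phi>. sentence \<phi> \<and> (\<forall>e\<in>assignments M. sat M e \<phi>)}"

definition models :: "'m struct \<Rightarrow> fm set \<Rightarrow> bool" where
  "models M T \<longleftrightarrow> is_struct M \<and> (\<forall>\<phi>\<in>T. \<forall>e\<in>assignments M. sat M e \<phi>)"

text \<open>
  Every formula is read as a partitioned formula \<open>\<phi>(x; y)\<close> whose object variable \<open>x\<close> is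
  variable 0 and whose parameter variables \<open>y\<close> are its other free variables. A parameter tuple
  is given by an assignment, of whose values only those at the free variables other than 0 matter.
  So \<open>instance_set M \<phi> e\<close> is the set \<open>\<phi>(M; a)\<close> with \<open>a\<close> the restriction of \<open>e\<close> to \<open>y\<close>.
\<close>

definition instance_set :: "'m struct \<Rightarrow> fm \<Rightarrow> (nat \<Rightarrow> 'm) \<Rightarrow> 'm set" where
  "instance_set M \<phi> e = {b \<in> univ M. sat M (e(0 := b)) \<phi>}"

section \<open>VC-minimality\<close>

definition directed_family :: "'m set set \<Rightarrow> bool" where
  "directed_family \<B> \<longleftrightarrow> (\<forall>A\<in>\<B>. \<forall>B\<in>\<B>. A \<subseteq> B \<or> B \<subseteq> A \<or> A \<inter> B = {})"

definition instances :: "'m struct \<Rightarrow> fm set \<Rightarrow> 'm set set" where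
  "instances M \<Psi> = {instance_set M \<psi> e | \<psi> e. \<psi> \<in> \<Psi> \<and> e \<in> assignments M}"

text \<open>
  HOL cannot quantify over all types, so the universes of the models of a theory range over the
  subsets of a type \<open>'m\<close>, made explicit by an argument \<open>TYPE('m)\<close>. The language is countable;
  hence, by the theorems of Loewenheim-Skolem and compactness, for a complete theory with infinite
  models the notions below do not depend on the choice of an infinite type \<open>'m\<close>.
\<close>

definition directed_formulas :: "'m itself \<Rightarrow> fm set \<Rightarrow> fm set \<Rightarrow> bool" where
  "directed_formulas _ T \<Psi> \<longleftrightarrow>
     (\<forall>M :: 'm struct. models M T \<longrightarrow> directed_family (instances M \<Psi>))"

inductive_set boolean_combinations :: "'m set \<Rightarrow> 'm set set \<Rightarrow> 'm set set"
  for X :: "'m set" and \<B> :: "'m set set" where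
  basic: "B \<in> \<B> \<Longrightarrow> B \<in> boolean_combinations X \<B>"
| empty: "{} \<in> boolean_combinations X \<B>"
| compl: "A \<in> boolean_combinations X \<B> \<Longrightarrow> X - A \<in> boolean_combinations X \<B>"
| union: "A \<in> boolean_combinations X \<B> \<Longrightarrow> B \<in> boolean_combinations X \<B> \<Longrightarrow>
            A \<union> B \<in> boolean_combinations X \<B>"

definition VC_minimal :: "'m itself \<Rightarrow> fm set \<Rightarrow> bool" where
  "VC_minimal U T \<longleftrightarrow>
     (\<exists>\<Psi>. directed_formulas U T \<Psi> \<and>
        (\<forall>M :: 'm struct. models M T \<longrightarrow>
           (\<forall>\<phi>. \<forall>e\<in>assignments M.
              instance_set M \<phi> e \<in> boolean_combinations (univ M) (instances M \<Psi>))))"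

section \<open>Convex orderability\<close>

definition convex_subset :: "'m set \<Rightarrow> 'm rel \<Rightarrow> 'm set \<Rightarrow> bool" where
  "convex_subset X r C \<longleftrightarrow> C \<subseteq> X \<and>
     (\<forall>x\<in>C. \<forall>y\<in>C. \<forall>z\<in>X. (x, z) \<in> r \<and> (z, y) \<in> r \<longrightarrow> z \<in> C)"

definition union_of_convex :: "'m set \<Rightarrow> 'm rel \<Rightarrow> nat \<Rightarrow> 'm set \<Rightarrow> bool" where
  "union_of_convex X r k A \<longleftrightarrow>
     (\<exists>\<C>. finite \<C> \<and> card \<C> \<le> k \<and> (\<forall>C\<in>\<C>. convex_subset X r C) \<and> A = \<Union>\<C>)"

definition convexly_orderable :: "'m struct \<Rightarrow> bool" where
  "convexly_orderable M \<longleftrightarrow>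
     (\<exists>r. linear_order_on (univ M) r \<and>
        (\<forall>\<phi>. \<exists>k. \<forall>e\<in>assignments M. union_of_convex (univ M) r k (instance_set M \<phi> e)))"

definition convexly_orderable_theory :: "'m itself \<Rightarrow> fm set \<Rightarrow> bool" where
  "convexly_orderable_theory _ T \<longleftrightarrow>
     (\<forall>M :: 'm struct. models M T \<longrightarrow> convexly_orderable M)"

section \<open>Valued fields\<close>

text \<open>
  The value group is the whole type \<open>'g\<close>, and \<open>\<Gamma> \<union> {\<infinity>}\<close> consists of the elements of
  \<open>'g extended\<close> other than \<open>Minf\<close>.
\<close>

locale valued_field = field K
  for K :: "('a, 'b) ring_scheme" (structure) +
  fixes v :: "'a \<Rightarrow> 'g::linordered_ab_group_add extended"
  assumes v_range: "x \<in> carrier K \<Longrightarrow> v x \<noteq> Minf"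
    and v_infinity: "x \<in> carrier K \<Longrightarrow> v x = Pinf \<longleftrightarrow> x = \<zero>"
    and v_mult: "x \<in> carrier K \<Longrightarrow> y \<in> carrier K \<Longrightarrow> v (x \<otimes> y) = v x + v y"
    and v_add: "x \<in> carrier K \<Longrightarrow> y \<in> carrier K \<Longrightarrow> min (v x) (v y) \<le> v (x \<oplus> y)"
    and v_onto: "\<exists>x\<in>carrier K. v x = Fin g"

definition divisible_group :: "'g::linordered_ab_group_add itself \<Rightarrow> bool" where
  "divisible_group _ \<longleftrightarrow> (\<forall>n::nat. n \<ge> 1 \<longrightarrow> (\<lambda>g::'g. \<Sum>i<n. g) ` UNIV = UNIV)"

definition valued_field_struct ::
  "('a, 'b) ring_scheme \<Rightarrow> ('a \<Rightarrow> 'g::linordered_ab_group_add extended) \<Rightarrow> 'a struct" where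
  "valued_field_struct K v =
     \<lparr>univ = carrier K, add_op = add K, mul_op = mult K, div_rel = (\<lambda>x y. v x \<le> v y)\<rparr>"

section \<open>The \<open>p\<close>-adic numbers\<close>

definition rat_padic_val :: "nat \<Rightarrow> rat \<Rightarrow> int extended" where
  "rat_padic_val p q =
     (if q = 0 then Pinf
      else Fin (int (multiplicity (int p) (fst (quotient_of q)))
              - int (multiplicity (int p) (snd (quotient_of q)))))"

definition padic_Cauchy :: "nat \<Rightarrow> (nat \<Rightarrow> rat) set" where
  "padic_Cauchy p =
     {s. \<forall>k::int. \<exists>N. \<forall>m\<ge>N. \<forall>n\<ge>N. Fin k \<le> rat_padic_val p (s m - s n)}"

definition padic_null :: "nat \<Rightarrow> (nat \<Rightarrow> rat) set" where
  "padic_null p = {s. \<forall>k::int. \<exists>N. \<forall>n\<ge>N. Fin k \<le> rat_padic_val p (s n)}"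

definition padic_Cauchy_ring :: "nat \<Rightarrow> (nat \<Rightarrow> rat) ring" where
  "padic_Cauchy_ring p =
     \<lparr>carrier = padic_Cauchy p, mult = (\<lambda>s t n. s n * t n), one = (\<lambda>n. 1),
      zero = (\<lambda>n. 0), add = (\<lambda>s t n. s n + t n)\<rparr>"

definition Qp :: "nat \<Rightarrow> (nat \<Rightarrow> rat) set ring" where
  "Qp p = padic_Cauchy_ring p Quot padic_null p"

text \<open>
  If the class \<open>X\<close> is nonzero, then the valuations of the terms of any \<open>s \<in> X\<close> are eventually
  constant, with a value independent of \<open>s\<close>; for the zero class the only value that is eventually
  attained by some null sequence is \<open>\<infinity>\<close>.
\<close>

definition padic_val :: "nat \<Rightarrow> (nat \<Rightarrow> rat) set \<Rightarrow> int extended" where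
  "padic_val p X = (THE g. \<exists>s\<in>X. \<forall>\<^sub>F n in sequentially. rat_padic_val p (s n) = g)"

end

theory Submission
  imports Defs "HOL-Library.Countable_Set"
begin

text \<open>
  In a convexly ordered valued field all balls are unions of at most \<open>l\<close>, and all sets
  \<open>S(a) = {x. v(x - a) \<in> n\<Gamma>}\<close> unions of at most \<open>k\<close>, convex sets. If \<open>n\<Gamma> \<noteq> \<Gamma>\<close>, one can choose in
  every ball \<open>l + 1\<close> disjoint subballs with mutual distances all in \<open>n\<Gamma>\<close>, or all outside of it. By
  the pigeonhole principle two of them have points in a common convex piece of the ball; iterating
  this through many levels of balls yields a point \<open>a\<close> and a long increasing chain above it
  that alternates between \<open>S(a)\<close> and its complement, which is impossible. The argument works in
  a countable elementary substructure, which can be realized on any infinite type.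

  For VC-minimality, the members of a directed family on a countable set are convex for a suitable
  linear order. The number of convex pieces of the instances of one formula is then bounded, by
  compactness, which is applied in the form of a countable elementary substructure of an ultrapower.
\<close>

section \<open>Ultrapowers\<close>

text \<open>The order that witnesses convex orderability is arbitrary, so it cannot be carried to an
  elementary extension; only the bounds \<open>k\<close> and \<open>l\<close>, uniform in the
  parameters, can be used. This fixes the shape of the chain: its lowest point \<open>a\<close>
  stays put while points are added on top, so that a single set \<open>S a\<close> is tested, and
  the exponents chosen at each level of balls decide whether the next point lies in it. In the
  compactness step, too, the order lives on the countable model alone. What travels between this
  model and the ultrapower is a formula: a boolean combination of instances is rewritten as an
  instance of one formula, and equality of two instances is first order. The ultrapower is cut down
  to a countable substructure because \<open>VC_minimal\<close> speaks only of structures on the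
  type \<open>'m\<close>, which may be countable.\<close>

lemma tm_val_cong:
  "(\<And>n. n \<in> tm_vars t \<Longrightarrow> e n = e' n) \<Longrightarrow> tm_val M e t = tm_val M e' t"
  by (induction t) auto

lemma sat_cong:
  "(\<And>n. n \<in> free_vars \<phi> \<Longrightarrow> e n = e' n) \<Longrightarrow> sat M e \<phi> \<longleftrightarrow> sat M e' \<phi>"
proof (induction \<phi> arbitrary: e e')
  case (Eq s t)
  then show ?case using tm_val_cong[of s e e' M] tm_val_cong[of t e e' M] by simp
next
  case (Divides s t)
  then show ?case using tm_val_cong[of s e e' M] tm_val_cong[of t e e' M] by simp
next
  case (Neg \<phi>)
  have "sat M e \<phi> \<longleftrightarrow> sat M e' \<phi>" by (rule Neg.IH) (simp add: Neg.prems)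
  then show ?case by simp
next
  case (Conj \<phi> \<psi>)
  have "sat M e \<phi> \<longleftrightarrow> sat M e' \<phi>" "sat M e \<psi> \<longleftrightarrow> sat M e' \<psi>"
    by (rule Conj.IH; simp add: Conj.prems)+
  then show ?case by simp
next
  case (Exists n \<phi>)
  have "sat M (e(n := b)) \<phi> \<longleftrightarrow> sat M (e'(n := b)) \<phi>" for b
    using Exists.prems by (intro Exists.IH) auto
  then show ?case by simp
qed

lemma finite_tm_vars [simp]: "finite (tm_vars t)"
  by (induction t) auto

lemma finite_free_vars [simp]: "finite (free_vars \<phi>)"
  by (induction \<phi>) auto

instance tm :: countable by countable_datatype
instance fm :: countable by countable_datatype

fun rename_tm :: "(nat \<Rightarrow> nat) \<Rightarrow> tm \<Rightarrow> tm" where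
  "rename_tm \<pi> (Var n) = Var (\<pi> n)"
| "rename_tm \<pi> (Add s t) = Add (rename_tm \<pi> s) (rename_tm \<pi> t)"
| "rename_tm \<pi> (Mul s t) = Mul (rename_tm \<pi> s) (rename_tm \<pi> t)"

text \<open>Bound variables are renamed as well, so that no capture occurs when \<open>\<pi>\<close> is injective.\<close>

fun rename :: "(nat \<Rightarrow> nat) \<Rightarrow> fm \<Rightarrow> fm" where
  "rename \<pi> (Eq s t) = Eq (rename_tm \<pi> s) (rename_tm \<pi> t)"
| "rename \<pi> (Divides s t) = Divides (rename_tm \<pi> s) (rename_tm \<pi> t)"
| "rename \<pi> (Neg \<phi>) = Neg (rename \<pi> \<phi>)"
| "rename \<pi> (Conj \<phi> \<psi>) = Conj (rename \<pi> \<phi>) (rename \<pi> \<psi>)"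
| "rename \<pi> (Exists n \<phi>) = Exists (\<pi> n) (rename \<pi> \<phi>)"

lemma tm_val_rename: "tm_val M e (rename_tm \<pi> t) = tm_val M (\<lambda>n. e (\<pi> n)) t"
  by (induction t) auto

lemma sat_rename:
  assumes "inj \<pi>"
  shows "sat M e (rename \<pi> \<phi>) \<longleftrightarrow> sat M (\<lambda>n. e (\<pi> n)) \<phi>"
proof (induction \<phi> arbitrary: e)
  case (Exists n \<phi>)
  have "(\<lambda>m. (e(\<pi> n := b)) (\<pi> m)) = (\<lambda>m. e (\<pi> m))(n := b)" for b
    using assms by (auto simp: fun_eq_iff inj_eq)
  then show ?case using Exists by simp
qed (auto simp: tm_val_rename)

section \<open>Ultrafilters\<close>

definition ultrafilter :: "'i filter \<Rightarrow> bool" where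
  "ultrafilter F \<longleftrightarrow> F \<noteq> bot \<and> (\<forall>P. eventually P F \<or> eventually (\<lambda>i. \<not> P i) F)"

lemma ultrafilter_eventually_not:
  assumes "ultrafilter F"
  shows "eventually (\<lambda>i. \<not> P i) F \<longleftrightarrow> \<not> eventually P F"
proof -
  have "False" if "eventually P F" "eventually (\<lambda>i. \<not> P i) F"
  proof -
    have "eventually (\<lambda>i. False) F" using that by eventually_elim simp
    then show False using assms by (simp add: ultrafilter_def eventually_False)
  qed
  then show ?thesis using assms by (auto simp: ultrafilter_def)
qed

text \<open>Smaller filters contain more sets, so Zorn's lemma is used to find a minimal proper
  filter. If it does not contain the complement of a set, its meet with the principal filter of that
  set is proper, and by minimality the set belongs to it.\<close>

lemma ex_ultrafilter:
  fixes F :: "'i filter"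
  assumes "F \<noteq> bot"
  shows "\<exists>U\<le>F. ultrafilter U"
proof -
  let ?A = "{G. G \<noteq> bot \<and> G \<le> F}"
  have "\<exists>U\<in>?A. \<forall>G\<in>?A. G \<le> U \<longrightarrow> G = U"
  proof (rule predicate_Zorn)
    show "partial_order_on ?A (relation_of (\<lambda>G H. H \<le> G) ?A)"
      by (rule partial_order_on_relation_ofI) auto
  next
    fix C assume C: "C \<in> Chains (relation_of (\<lambda>G H. H \<le> G) ?A)"
    then have sub: "C \<subseteq> ?A" and tot: "\<And>G H. G \<in> C \<Longrightarrow> H \<in> C \<Longrightarrow> G \<le> H \<or> H \<le> G"
      by (auto simp: Chains_def relation_of_def)
    show "\<exists>U\<in>?A. \<forall>G\<in>C. U \<le> G"
    proof (cases "C = {}")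
      case True
      then show ?thesis using assms by auto
    next
      case False
      \<comment> \<open>The infimum of a chain of filters is their union, so if it were improper, a
        member would be.\<close>
      have ev: "eventually P (Inf C) \<longleftrightarrow> (\<exists>G\<in>C. eventually P G)" for P
      proof (rule eventually_Inf_base[OF False])
        fix G H assume "G \<in> C" "H \<in> C"
        then show "\<exists>x\<in>C. x \<le> inf G H" using tot by (metis inf.absorb_iff1 inf.commute order_refl)
      qed
      have "Inf C \<noteq> bot"
      proof
        assume "Inf C = bot"
        then have "eventually (\<lambda>_. False) (Inf C)" by simp
        then obtain G where "G \<in> C" "eventually (\<lambda>_. False) G" using ev by blast
        then show False using sub by (auto simp: eventually_False)
      qed
      moreover have "Inf C \<le> F"
        using False sub by (metis (mono_tags, lifting) Inf_lower all_not_in_conv mem_Collect_eq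
            order_trans subset_iff)
      ultimately show ?thesis by (auto intro: Inf_lower)
    qed
  qed
  then obtain U where U: "U \<noteq> bot" "U \<le> F" and min: "\<And>G. G \<noteq> bot \<Longrightarrow> G \<le> U \<Longrightarrow> G = U"
    by (smt (verit) mem_Collect_eq order_trans)
  have "eventually P U \<or> eventually (\<lambda>i. \<not> P i) U" for P
  proof (cases "inf U (principal {i. P i}) = bot")
    case True
    then show ?thesis
      by (auto simp: trivial_limit_def eventually_inf_principal)
  next
    case False
    then have "U \<le> principal {i. P i}"
      using min[OF False] by (metis inf.cobounded1 inf.cobounded2)
    then show ?thesis by (simp add: le_principal)
  qed
  then show ?thesis using U by (auto simp: ultrafilter_def)
qed

section \<open>Countable Skolem hulls\<close>

lemma countable_closure:
  fixes op :: "'c::countable \<Rightarrow> 'b list \<Rightarrow> 'b"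
  assumes "countable S"
  obtains W where "countable W" "S \<subseteq> W" "\<And>c xs. set xs \<subseteq> W \<Longrightarrow> op c xs \<in> W"
proof -
  define A where "A = rec_nat S (\<lambda>_ W. W \<union> (\<lambda>(c, xs). op c xs) ` (UNIV \<times> lists W))"
  have A0: "A 0 = S" and ASuc: "A (Suc k) = A k \<union> (\<lambda>(c, xs). op c xs) ` (UNIV \<times> lists (A k))" for k
    by (simp_all add: A_def)
  have count: "countable (A k)" for k
    by (induction k) (auto simp: A0 ASuc assms)
  have mono: "A k \<subseteq> A l" if "k \<le> l" for k l
    by (rule lift_Suc_mono_le[OF _ that]) (auto simp: ASuc)
  \<comment> \<open>Argument lists are finite and the stages increase, so each list lies in one
    stage and its value in the next.\<close>
  have fin: "\<exists>k. set xs \<subseteq> A k" if "set xs \<subseteq> (\<Union>k. A k)" for xs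
    using that
  proof (induction xs)
    case (Cons x xs)
    then obtain k l where "set xs \<subseteq> A k" "x \<in> A l" by auto
    then have "set (x # xs) \<subseteq> A (max k l)"
      using mono[of k "max k l"] mono[of l "max k l"] by auto
    then show ?case ..
  qed auto
  have "op c xs \<in> (\<Union>k. A k)" if xs: "set xs \<subseteq> (\<Union>k. A k)" for c xs
  proof -
    obtain k where "set xs \<subseteq> A k" using fin[OF xs] by blast
    then have "(c, xs) \<in> UNIV \<times> lists (A k)" by auto
    then have "op c xs \<in> A (Suc k)" unfolding ASuc by force
    then show ?thesis by blast
  qed
  then show ?thesis using that[of "\<Union>k. A k"] count A0 by blast
qed

text \<open>\<open>W\<close> is a set of elements of a power of \<open>N\<close>. One
  \<open>w\<close> has to serve all indices at once, so the condition mentions no filter and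
  provides the witness in the existential case of Los's theorem.\<close>

definition skolem_closed :: "'a struct \<Rightarrow> ('i \<Rightarrow> 'a) set \<Rightarrow> bool" where
  "skolem_closed N W \<longleftrightarrow> (\<forall>\<phi> n e. (\<forall>m. e m \<in> W) \<longrightarrow>
     (\<exists>w\<in>W. \<forall>i. (\<exists>b\<in>univ N. sat N ((\<lambda>m. e m i)(n := b)) \<phi>) \<longrightarrow>
                 sat N ((\<lambda>m. e m i)(n := w i)) \<phi>))"

text \<open>One choice function for each formula and quantified variable, applied separately at each
  index, suffices. There are countably many, so the hull stays countable.\<close>

lemma skolem_hull:
  fixes N :: "'a struct" and S :: "('i \<Rightarrow> 'a) set"
  assumes N: "univ N \<noteq> {}" and S: "countable S" "\<forall>s\<in>S. \<forall>i. s i \<in> univ N"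
  shows "\<exists>W. countable W \<and> S \<subseteq> W \<and> W \<noteq> {} \<and> (\<forall>w\<in>W. \<forall>i. w i \<in> univ N) \<and> skolem_closed N W"
proof -
  obtain a where a: "a \<in> univ N" using N by blast
  let ?S = "insert (\<lambda>_. a) S" and ?X = "{s. \<forall>i. s i \<in> univ N}"
  let ?asg = "\<lambda>xs i m. (if m < length xs then xs ! m else (\<lambda>_. a)) (i::'i)"
  let ?good = "\<lambda>\<phi> n xs i b. (\<exists>b\<in>univ N. sat N ((?asg xs i)(n := b)) \<phi>) \<longrightarrow>
                  sat N ((?asg xs i)(n := b)) \<phi>"
  define op where "op = (\<lambda>(\<phi>, n) xs i. SOME b. b \<in> univ N \<and> ?good \<phi> n xs i b)"
  have op: "op (\<phi>, n) xs i \<in> univ N \<and> ?good \<phi> n xs i (op (\<phi>, n) xs i)" for \<phi> n xs i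
    unfolding op_def prod.case by (rule someI_ex) (use a in blast)
  obtain W0 where W0: "countable W0" "?S \<subseteq> W0" "\<And>c xs. set xs \<subseteq> W0 \<Longrightarrow> op c xs \<in> W0"
    using countable_closure[of ?S op] S by auto
  \<comment> \<open>\<open>W0\<close> is only known to contain the generators and to be closed under
    \<open>op\<close>. All values of \<open>op\<close> lie in \<open>?X\<close>, so the intersection
    is still closed.\<close>
  let ?W = "W0 \<inter> ?X"
  have "skolem_closed N ?W"
    unfolding skolem_closed_def
  proof (intro allI impI)
    fix \<phi> n and e :: "nat \<Rightarrow> 'i \<Rightarrow> 'a"
    assume e: "\<forall>m. e m \<in> ?W"
    \<comment> \<open>Only finitely many values of \<open>e\<close> matter, so they fit into a list;
      the inserted 0 gives \<open>Max\<close> a nonempty set.\<close>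
    define B where "B = Suc (Max (insert 0 (free_vars \<phi>)))"
    have B: "m < B" if "m \<in> free_vars \<phi>" for m
      using that by (simp add: B_def less_Suc_eq_le)
    define xs where "xs = map e [0..<B]"
    have asg: "sat N ((?asg xs i)(n := b)) \<phi> \<longleftrightarrow> sat N ((\<lambda>m. e m i)(n := b)) \<phi>" for i b
      by (rule sat_cong) (use B in \<open>auto simp: xs_def\<close>)
    have "op (\<phi>, n) xs \<in> ?W"
      using W0(3)[of xs "(\<phi>, n)"] e op[of \<phi> n xs] by (auto simp: xs_def)
    then show "\<exists>w\<in>?W. \<forall>i. (\<exists>b\<in>univ N. sat N ((\<lambda>m. e m i)(n := b)) \<phi>) \<longrightarrow>
                  sat N ((\<lambda>m. e m i)(n := w i)) \<phi>"
      using op[of \<phi> n xs, unfolded asg] by (intro bexI[of _ "op (\<phi>, n) xs"]) blast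
  qed
  moreover have "countable ?W" "S \<subseteq> ?W" "?W \<noteq> {}" "\<forall>w\<in>?W. \<forall>i. w i \<in> univ N"
    using W0 S a by auto
  ultimately show ?thesis by blast
qed

text \<open>Los's theorem for the Skolem hull of \<open>S\<close> in the ultrapower. The hull has
  countably many classes and thus fits into any infinite type; \<open>g\<close> picks
  representatives, so that truth in \<open>M\<close> is computed index by index.\<close>

lemma skolem_ultrapower:
  fixes N :: "'a struct" and F :: "'i filter" and S :: "('i \<Rightarrow> 'a) set"
  assumes inf: "infinite (UNIV :: 'm set)" and N: "is_struct N" and F: "ultrafilter F"
    and S: "countable S" "\<forall>s\<in>S. \<forall>i. s i \<in> univ N"
  obtains M :: "'m struct" and g :: "'m \<Rightarrow> 'i \<Rightarrow> 'a"
  where "is_struct M" "countable (univ M)" "\<And>b i. b \<in> univ M \<Longrightarrow> g b i \<in> univ N"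
    "\<And>s. s \<in> S \<Longrightarrow> \<exists>b\<in>univ M. \<forall>\<^sub>F i in F. g b i = s i"
    "\<And>e \<phi>. e \<in> assignments M \<Longrightarrow> sat M e \<phi> \<longleftrightarrow> (\<forall>\<^sub>F i in F. sat N (\<lambda>n. g (e n) i) \<phi>)"
proof -
  have ne: "univ N \<noteq> {}" using N by (simp add: is_struct_def)
  obtain W where W: "countable W" "S \<subseteq> W" "W \<noteq> {}" "\<forall>w\<in>W. \<forall>i. w i \<in> univ N"
    and sk: "skolem_closed N W"
    using skolem_hull[OF ne S] by blast
  have skolem: "\<exists>w\<in>W. \<forall>i. (\<exists>b\<in>univ N. sat N ((\<lambda>m. e m i)(n := b)) \<phi>) \<longrightarrow>
                  sat N ((\<lambda>m. e m i)(n := w i)) \<phi>" if "\<And>m. e m \<in> W" for \<phi> n e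
    using sk[unfolded skolem_closed_def, rule_format, of e] that by blast
  \<comment> \<open>Skolem closure is applied to a formula whose only witness is the value of the
    operation.\<close>
  have add_closed: "(\<lambda>i. add_op N (x i) (y i)) \<in> W"
    and mul_closed: "(\<lambda>i. mul_op N (x i) (y i)) \<in> W" if "x \<in> W" "y \<in> W" for x y
  proof -
    let ?e = "(\<lambda>_. x)(1 := y) :: nat \<Rightarrow> _"
    have e: "\<And>m. ?e m \<in> W" using that by auto
    have cl: "add_op N (x i) (y i) \<in> univ N" "mul_op N (x i) (y i) \<in> univ N" for i
      using N that W(4) by (auto simp: is_struct_def)
    obtain w where w: "w \<in> W" "\<forall>i. (\<exists>b\<in>univ N. sat N ((\<lambda>m. ?e m i)(2 := b)) (Eq (Var 2) (Add (Var 0) (Var 1))))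
        \<longrightarrow> sat N ((\<lambda>m. ?e m i)(2 := w i)) (Eq (Var 2) (Add (Var 0) (Var 1)))"
      using skolem[where e = ?e and n = 2 and \<phi> = "Eq (Var 2) (Add (Var 0) (Var 1))", OF e] by blast
    have "w i = add_op N (x i) (y i)" for i
      using w(2)[rule_format, of i] cl[of i] by simp
    then have "w = (\<lambda>i. add_op N (x i) (y i))" by auto
    with w(1) show "(\<lambda>i. add_op N (x i) (y i)) \<in> W" by simp
    obtain w where w: "w \<in> W" "\<forall>i. (\<exists>b\<in>univ N. sat N ((\<lambda>m. ?e m i)(2 := b)) (Eq (Var 2) (Mul (Var 0) (Var 1))))
        \<longrightarrow> sat N ((\<lambda>m. ?e m i)(2 := w i)) (Eq (Var 2) (Mul (Var 0) (Var 1)))"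
      using skolem[where e = ?e and n = 2 and \<phi> = "Eq (Var 2) (Mul (Var 0) (Var 1))", OF e] by blast
    have "w i = mul_op N (x i) (y i)" for i
      using w(2)[rule_format, of i] cl[of i] by simp
    then have "w = (\<lambda>i. mul_op N (x i) (y i))" by auto
    with w(1) show "(\<lambda>i. mul_op N (x i) (y i)) \<in> W" by simp
  qed
  define eqv where "eqv = (\<lambda>x y. \<forall>\<^sub>F i in F. x i = (y i :: 'a))"
  have refl: "eqv x x" for x by (simp add: eqv_def)
  have sym: "eqv y x" if "eqv x y" for x y using that by (simp add: eqv_def eq_commute)
  have trans: "eqv x z" if "eqv x y" "eqv y z" for x y z
    using that unfolding eqv_def by eventually_elim simp
  obtain f :: "nat \<Rightarrow> 'm" where f: "inj f"
    using infinite_countable_subset[OF inf] by auto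
  \<comment> \<open>A class is named by the least position of one of its elements in an enumeration
    of \<open>W\<close>, and positions are embedded into \<open>'m\<close> by
    \<open>f\<close>.\<close>
  define h where "h = (\<lambda>w. f (LEAST j. eqv (from_nat_into W j) w))"
  have h_eq: "h x = h y \<longleftrightarrow> eqv x y" if "x \<in> W" "y \<in> W" for x y
  proof
    assume "eqv x y"
    then have "\<And>z. eqv z x \<longleftrightarrow> eqv z y" using sym trans by blast
    then show "h x = h y" by (simp add: h_def)
  next
    assume "h x = h y"
    then have eq: "(LEAST j. eqv (from_nat_into W j) x) = (LEAST j. eqv (from_nat_into W j) y)"
      using f by (simp add: h_def inj_eq)
    have L: "eqv (from_nat_into W (LEAST j. eqv (from_nat_into W j) w)) w" if "w \<in> W" for w
      by (rule LeastI[of _ "to_nat_on W w"]) (simp add: W(1) that refl)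
    show "eqv x y" using trans[OF sym[OF L[OF that(1)]]] L[OF that(2)] eq by simp
  qed
  define g where "g = inv_into W h"
  have gW: "g b \<in> W" and hg: "h (g b) = b" if "b \<in> h ` W" for b
    using that by (auto simp: g_def inv_into_into f_inv_into_f)
  have gh: "eqv (g (h w)) w" if "w \<in> W" for w
    using h_eq[of "g (h w)" w] hg[of "h w"] gW[of "h w"] that by simp
  define M where "M = \<lparr>univ = h ` W,
      add_op = (\<lambda>b c. h (\<lambda>i. add_op N (g b i) (g c i))),
      mul_op = (\<lambda>b c. h (\<lambda>i. mul_op N (g b i) (g c i))),
      div_rel = (\<lambda>b c. \<forall>\<^sub>F i in F. div_rel N (g b i) (g c i))\<rparr>"
  have univ: "univ M = h ` W" by (simp add: M_def)
  have struct: "is_struct M"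
    using W(3) by (simp add: is_struct_def M_def add_closed mul_closed gW)
  have tm: "tm_val M e t \<in> h ` W \<and> eqv (g (tm_val M e t)) (\<lambda>i. tm_val N (\<lambda>n. g (e n) i) t)"
    if e: "e \<in> assignments M" for e t
  proof (induction t)
    case (Var n)
    then show ?case using e by (simp add: assignments_def univ refl)
  next
    case (Add s t)
    then have mem: "(\<lambda>i. add_op N (g (tm_val M e s) i) (g (tm_val M e t) i)) \<in> W"
      using gW add_closed by simp
    have 1: "eqv (g (tm_val M e (Add s t))) (\<lambda>i. add_op N (g (tm_val M e s) i) (g (tm_val M e t) i))"
      using gh[OF mem] by (simp add: M_def)
    have "eqv (\<lambda>i. add_op N (g (tm_val M e s) i) (g (tm_val M e t) i))
       (\<lambda>i. tm_val N (\<lambda>n. g (e n) i) (Add s t))"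
      using conjunct2[OF Add(1)] conjunct2[OF Add(2)]
      unfolding eqv_def by eventually_elim simp
    then show ?case using mem trans[OF 1] by (simp add: M_def)
  next
    case (Mul s t)
    then have mem: "(\<lambda>i. mul_op N (g (tm_val M e s) i) (g (tm_val M e t) i)) \<in> W"
      using gW mul_closed by simp
    have 1: "eqv (g (tm_val M e (Mul s t))) (\<lambda>i. mul_op N (g (tm_val M e s) i) (g (tm_val M e t) i))"
      using gh[OF mem] by (simp add: M_def)
    have "eqv (\<lambda>i. mul_op N (g (tm_val M e s) i) (g (tm_val M e t) i))
       (\<lambda>i. tm_val N (\<lambda>n. g (e n) i) (Mul s t))"
      using conjunct2[OF Mul(1)] conjunct2[OF Mul(2)]
      unfolding eqv_def by eventually_elim simp
    then show ?case using mem trans[OF 1] by (simp add: M_def)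
  qed
  have los: "sat M e \<phi> \<longleftrightarrow> (\<forall>\<^sub>F i in F. sat N (\<lambda>n. g (e n) i) \<phi>)" if "e \<in> assignments M" for e \<phi>
    using that
  proof (induction \<phi> arbitrary: e)
    case (Eq s t)
    let ?s = "tm_val M e s" and ?t = "tm_val M e t"
    have mem: "?s \<in> h ` W" "?t \<in> h ` W" using tm[OF Eq] by auto
    have "?s = ?t \<longleftrightarrow> eqv (g ?s) (g ?t)"
      using h_eq[OF gW[OF mem(1)] gW[OF mem(2)]] hg[OF mem(1)] hg[OF mem(2)] by simp
    also have "\<dots> \<longleftrightarrow> eqv (\<lambda>i. tm_val N (\<lambda>n. g (e n) i) s) (\<lambda>i. tm_val N (\<lambda>n. g (e n) i) t)"
      using conjunct2[OF tm[OF Eq, of s]] conjunct2[OF tm[OF Eq, of t]] sym trans by blast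
    finally show ?case by (simp add: eqv_def)
  next
    case (Divides s t)
    have "\<forall>\<^sub>F i in F. div_rel N (g (tm_val M e s) i) (g (tm_val M e t) i) \<longleftrightarrow>
        div_rel N (tm_val N (\<lambda>n. g (e n) i) s) (tm_val N (\<lambda>n. g (e n) i) t)"
      using conjunct2[OF tm[OF Divides, of s]] conjunct2[OF tm[OF Divides, of t]]
      unfolding eqv_def by eventually_elim simp
    then show ?case by (simp add: M_def) (rule eventually_subst)
  next
    case (Neg \<phi>)
    then show ?case by (simp add: ultrafilter_eventually_not[OF F])
  next
    case (Conj \<phi> \<psi>)
    then show ?case by (simp add: eventually_conj_iff)
  next
    case (Exists n \<phi>)
    let ?e = "\<lambda>i m. g (e m) i"
    have upd: "e(n := b) \<in> assignments M" if "b \<in> univ M" for b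
      using Exists.prems that by (simp add: assignments_def)
    have shift: "(\<lambda>m. g ((e(n := b)) m) i) = (?e i)(n := g b i)" for b i by auto
    have eW: "\<And>m. g (e m) \<in> W" using Exists.prems gW by (simp add: assignments_def univ)
    have "(\<exists>b\<in>univ M. \<forall>\<^sub>F i in F. sat N ((?e i)(n := g b i)) \<phi>) \<longleftrightarrow>
          (\<forall>\<^sub>F i in F. \<exists>b\<in>univ N. sat N ((?e i)(n := b)) \<phi>)"
    proof
      assume "\<exists>b\<in>univ M. \<forall>\<^sub>F i in F. sat N ((?e i)(n := g b i)) \<phi>"
      then obtain b where "b \<in> univ M" "\<forall>\<^sub>F i in F. sat N ((?e i)(n := g b i)) \<phi>" by blast
      then show "\<forall>\<^sub>F i in F. \<exists>b\<in>univ N. sat N ((?e i)(n := b)) \<phi>"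
        using gW W(4) univ by (auto elim!: eventually_mono)
    next
      \<comment> \<open>The witnesses exist index by index; Skolem closure provides a single element
        of \<open>W\<close> that collects them.\<close>
      assume ev: "\<forall>\<^sub>F i in F. \<exists>b\<in>univ N. sat N ((?e i)(n := b)) \<phi>"
      obtain w where w: "w \<in> W" "\<And>i. (\<exists>b\<in>univ N. sat N ((?e i)(n := b)) \<phi>) \<longrightarrow>
                  sat N ((?e i)(n := w i)) \<phi>"
        using skolem[of "\<lambda>m. g (e m)" n \<phi>] eW by blast
      have "\<forall>\<^sub>F i in F. sat N ((?e i)(n := g (h w) i)) \<phi>"
        using ev gh[OF w(1)] unfolding eqv_def by eventually_elim (use w(2) in simp)
      then show "\<exists>b\<in>univ M. \<forall>\<^sub>F i in F. sat N ((?e i)(n := g b i)) \<phi>"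
        using w(1) univ by blast
    qed
    moreover have "sat M (e(n := b)) \<phi> \<longleftrightarrow> (\<forall>\<^sub>F i in F. sat N ((?e i)(n := g b i)) \<phi>)"
      if "b \<in> univ M" for b
      using Exists.IH[OF upd[OF that]] unfolding shift .
    ultimately show ?case by simp
  qed
  show ?thesis
  proof (rule that[of M g])
    show "is_struct M" by (fact struct)
    show "sat M e \<phi> \<longleftrightarrow> (\<forall>\<^sub>F i in F. sat N (\<lambda>n. g (e n) i) \<phi>)" if "e \<in> assignments M" for e \<phi>
      using that by (rule los)
    show "countable (univ M)" using W(1) univ by simp
    show "g b i \<in> univ N" if "b \<in> univ M" for b i using that gW W(4) univ by simp
    show "\<exists>b\<in>univ M. \<forall>\<^sub>F i in F. g b i = s i" if "s \<in> S" for s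
      using gh[of s] that W(2) univ unfolding eqv_def by blast
  qed
qed

section \<open>VC-minimality implies convex orderability\<close>

lemma union_of_convex_mono: "union_of_convex X r k A \<Longrightarrow> k \<le> l \<Longrightarrow> union_of_convex X r l A"
  unfolding union_of_convex_def using order_trans by blast

lemma union_of_convex_empty: "union_of_convex X r 0 {}"
  unfolding union_of_convex_def by (intro exI[of _ "{}"]) auto

lemma union_of_convex_single: "convex_subset X r A \<Longrightarrow> union_of_convex X r 1 A"
  unfolding union_of_convex_def by (intro exI[of _ "{A}"]) auto

lemma union_of_convex_Un:
  assumes "union_of_convex X r k A" "union_of_convex X r l B"
  shows "union_of_convex X r (k + l) (A \<union> B)"
proof -
  obtain C D where "finite C" "card C \<le> k" "\<forall>c\<in>C. convex_subset X r c" "A = \<Union>C"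
    and "finite D" "card D \<le> l" "\<forall>c\<in>D. convex_subset X r c" "B = \<Union>D"
    using assms unfolding union_of_convex_def by blast
  moreover from this have "card (C \<union> D) \<le> k + l"
    using card_Un_le[of C D] by linarith
  ultimately show ?thesis
    unfolding union_of_convex_def by (intro exI[of _ "C \<union> D"]) auto
qed

text \<open>A point outside \<open>\<Union>\<C>\<close> is classified by the number of members of \<open>\<C>\<close> with an element below it.\<close>

lemma union_of_convex_compl:
  assumes lin: "linear_order_on X r" and "union_of_convex X r k A"
  shows "union_of_convex X r (Suc k) (X - A)"
proof -
  obtain C where C: "finite C" "card C \<le> k" "\<forall>c\<in>C. convex_subset X r c" "A = \<Union>C"
    using assms unfolding union_of_convex_def by blast
  have trans: "(x, z) \<in> r" if "(x, y) \<in> r" "(y, z) \<in> r" for x y z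
    using lin that by (meson linear_order_on_def partial_order_on_def preorder_on_def transD)
  define below where "below z = {c \<in> C. \<exists>y\<in>c. (y, z) \<in> r}" for z
  have fin: "finite (below z)" for z using C(1) by (simp add: below_def)
  have mono: "below y \<subseteq> below z" if "(y, z) \<in> r" for y z
    using trans that by (auto simp: below_def)
  have le: "card (below z) \<le> k" for z
    using card_mono[of C "below z"] C(1,2) by (auto simp: below_def)
  define D where "D j = {z \<in> X - A. card (below z) = j}" for j
  have "convex_subset X r (D j)" for j
    unfolding convex_subset_def
  proof (intro conjI ballI impI)
    fix x y z assume x: "x \<in> D j" and y: "y \<in> D j" and z: "z \<in> X" "(x, z) \<in> r \<and> (z, y) \<in> r"
    have "below x = below y"
      using card_subset_eq[OF fin[of y]] mono[of x y] trans[of x z y] x y z by (auto simp: D_def)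
    moreover have "below x \<subseteq> below z" "below z \<subseteq> below y" using mono z by auto
    ultimately have eq: "below x = below z" by auto
    have "z \<notin> A"
    proof
      assume "z \<in> A"
      then obtain c where c: "c \<in> C" "z \<in> c" using C(4) by blast
      then have "c \<in> below y" using z by (auto simp: below_def)
      then have "c \<in> below x" using \<open>below x = below y\<close> by simp
      then obtain w where "w \<in> c" "(w, x) \<in> r" by (auto simp: below_def)
      then have "x \<in> c"
        using C(3) c z x unfolding convex_subset_def D_def by blast
      then show False using x c C(4) by (auto simp: D_def)
    qed
    then show "z \<in> D j" using x z eq by (simp add: D_def)
  qed (auto simp: D_def)
  moreover have "card (D ` {..k}) \<le> Suc k"
    using card_image_le[of "{..k}" D] by simp
  moreover have "X - A = \<Union>(D ` {..k})" using le by (auto simp: D_def)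
  ultimately show ?thesis
    unfolding union_of_convex_def by (intro exI[of _ "D ` {..k}"]) auto
qed

text \<open>
  The maximal union of members of the family around \<open>x\<close> that misses \<open>y\<close>. Points \<open>x\<close> and \<open>y\<close> are
  compared by the least elements, in a fixed enumeration, of the disjoint sets \<open>side \<B> x y\<close> and
  \<open>side \<B> y x\<close>.
\<close>

definition side :: "'m set set \<Rightarrow> 'm \<Rightarrow> 'm \<Rightarrow> 'm set" where
  "side \<B> x y = insert x (\<Union>{B \<in> \<B>. x \<in> B \<and> y \<notin> B})"

text \<open>A member that contains a point of \<open>B\<close> but not \<open>z\<close> is
  comparable with \<open>B\<close>: it either lies in \<open>B\<close>, which belongs to the union
  itself, or contains both points. A member around \<open>z\<close> cannot lie in \<open>B\<close>,
  so it contains both \<open>x\<close> and \<open>y\<close> or neither.\<close>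

lemma side_separated:
  assumes "directed_family \<B>" "B \<in> \<B>" "x \<in> B" "y \<in> B" "z \<notin> B"
  shows "side \<B> x z = side \<B> y z" "side \<B> z x = side \<B> z y"
proof -
  have dir: "C \<subseteq> D \<or> D \<subseteq> C \<or> C \<inter> D = {}" if "C \<in> \<B>" "D \<in> \<B>" for C D
    using assms(1) that by (simp add: directed_family_def)
  have sub: "side \<B> u z \<subseteq> side \<B> w z" if "u \<in> B" "w \<in> B" for u w
  proof
    fix a assume "a \<in> side \<B> u z"
    then consider "a = u" | C where "C \<in> \<B>" "u \<in> C" "z \<notin> C" "a \<in> C"
      by (auto simp: side_def)
    then show "a \<in> side \<B> w z"
    proof cases
      case 1
      then show ?thesis using assms that by (auto simp: side_def)
    next
      case 2
      then have "C \<subseteq> B \<or> B \<subseteq> C" using dir[of C B] assms(2) that by auto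
      then show ?thesis using 2 assms that by (auto simp: side_def)
    qed
  qed
  show "side \<B> x z = side \<B> y z" using sub[of x y] sub[of y x] assms by auto
  have "x \<in> C \<longleftrightarrow> y \<in> C" if "C \<in> \<B>" "z \<in> C" for C
    using dir[of C B] that assms by blast
  then have "{C \<in> \<B>. z \<in> C \<and> x \<notin> C} = {C \<in> \<B>. z \<in> C \<and> y \<notin> C}"
    by blast
  then show "side \<B> z x = side \<B> z y" by (simp add: side_def)
qed

text \<open>A member around \<open>x\<close> that misses \<open>y\<close> and one around
  \<open>y\<close> that misses \<open>x\<close> are not nested, hence disjoint.\<close>

lemma side_disjoint:
  assumes "directed_family \<B>" "x \<noteq> y"
  shows "side \<B> x y \<inter> side \<B> y x = {}"
  using assms unfolding side_def directed_family_def by blast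

text \<open>Two points of a member compare in the same way with any point outside, by
  \<open>side_separated\<close>, so no outside point lies between them. Countability of
  \<open>X\<close> supplies the enumeration that turns disjoint sides into distinct numbers.\<close>

lemma directed_family_convex_order:
  fixes X :: "'m set"
  assumes "countable X" and dir: "directed_family \<B>" and sub: "\<And>B. B \<in> \<B> \<Longrightarrow> B \<subseteq> X"
  obtains r where "linear_order_on X r" "\<And>B. B \<in> \<B> \<Longrightarrow> convex_subset X r B"
proof -
  define m where "m A = (LEAST n. n \<in> to_nat_on X ` A)" for A
  have m: "m A \<in> to_nat_on X ` A" if "A \<noteq> {}" for A
    unfolding m_def using LeastI_ex[of "\<lambda>n. n \<in> to_nat_on X ` A"] that by blast
  have side_sub: "side \<B> x y \<subseteq> X" if "x \<in> X" for x y
    using sub that by (auto simp: side_def)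
  define lt where "lt x y \<longleftrightarrow> m (side \<B> x y) < m (side \<B> y x)" for x y
  have total: "lt x y \<or> lt y x" if "x \<in> X" "y \<in> X" "x \<noteq> y" for x y
  proof -
    have "m (side \<B> x y) \<noteq> m (side \<B> y x)"
    proof
      assume eq: "m (side \<B> x y) = m (side \<B> y x)"
      obtain a where a: "a \<in> side \<B> x y" "m (side \<B> x y) = to_nat_on X a"
        using m[of "side \<B> x y"] by (auto simp: side_def)
      obtain b where b: "b \<in> side \<B> y x" "m (side \<B> y x) = to_nat_on X b"
        using m[of "side \<B> y x"] by (auto simp: side_def)
      have "a = b"
        using a b eq side_sub that inj_on_to_nat_on[OF assms(1)] by (metis inj_onD subsetD)
      then show False using a b side_disjoint[OF dir that(3)] by blast
    qed
    then show ?thesis by (auto simp: lt_def)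
  qed
  have sep: "lt x z \<longleftrightarrow> lt y z" "lt z x \<longleftrightarrow> lt z y" if "B \<in> \<B>" "x \<in> B" "y \<in> B" "z \<notin> B" for B x y z
    using side_separated[OF dir that] by (simp_all add: lt_def)
  have trans: "lt x z" if "lt x y" "lt y z" for x y z
  proof -
    consider B where "B \<in> \<B>" "x \<in> B" "y \<in> B" "z \<notin> B"
      | B where "B \<in> \<B>" "y \<in> B" "z \<in> B" "x \<notin> B"
      | B where "B \<in> \<B>" "x \<in> B" "z \<in> B" "y \<notin> B"
      | "\<forall>B\<in>\<B>. (x \<in> B \<and> y \<in> B \<longrightarrow> z \<in> B) \<and> (y \<in> B \<and> z \<in> B \<longrightarrow> x \<in> B) \<and> (x \<in> B \<and> z \<in> B \<longrightarrow> y \<in> B)"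
      by blast
    then show ?thesis
    proof cases
      case 1
      then show ?thesis using sep that by blast
    next
      case 2
      then show ?thesis using sep that by blast
    next
      case 3
      \<comment> \<open>Here \<open>B\<close> separates \<open>y\<close> from \<open>x\<close> and
        \<open>z\<close>, which are therefore on the same side of \<open>y\<close>, against the
        assumption.\<close>
      then have "lt z y" using sep that by blast
      then show ?thesis using that by (simp add: lt_def)
    next
      case 4
      \<comment> \<open>A member with two of the points contains the third, so a member around one
        point that misses another misses both. Each side then depends on its first point alone, and
        three numbers are compared.\<close>
      then have "side \<B> x y = side \<B> x z" "side \<B> y x = side \<B> y z" "side \<B> z x = side \<B> z y"
        unfolding side_def by blast+
      then show ?thesis using that by (simp add: lt_def)
    qed
  qed
  have irrefl: "\<not> lt x x" for x by (simp add: lt_def)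
  define r where "r = {(x, y). x \<in> X \<and> y \<in> X \<and> (x = y \<or> lt x y)}"
  have "linear_order_on X r"
    unfolding linear_order_on_def partial_order_on_def preorder_on_def
  proof (intro conjI)
    show "trans r" unfolding trans_def r_def using trans by blast
    show "antisym r" unfolding antisym_def r_def using trans irrefl by blast
    show "total_on X r" unfolding total_on_def r_def using total by blast
    show "refl_on X r" unfolding refl_on_def r_def by blast
    show "r \<subseteq> X \<times> X" unfolding r_def by blast
  qed
  moreover have "convex_subset X r B" if "B \<in> \<B>" for B
    unfolding convex_subset_def
  proof (intro conjI ballI impI)
    fix x y z assume "x \<in> B" "y \<in> B" "z \<in> X" "(x, z) \<in> r \<and> (z, y) \<in> r"
    then show "z \<in> B"
      using sep[OF that, of x y z] trans[of y z y] irrefl[of y] by (auto simp: r_def)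
  qed (use sub that in blast)
  ultimately show ?thesis using that by blast
qed

section \<open>Instances of formulas and their parameters\<close>

lemma instance_set_cong:
  "(\<And>n. n \<in> free_vars \<phi> \<Longrightarrow> n \<noteq> 0 \<Longrightarrow> e n = e' n) \<Longrightarrow> instance_set M \<phi> e = instance_set M \<phi> e'"
  unfolding instance_set_def by (intro Collect_cong conj_cong refl sat_cong) auto

text \<open>With \<open>odd_vars\<close> this gives two formulas disjoint parameter variables but a
  common object variable, so that one assignment carries the parameters of both.\<close>

definition even_vars :: "nat \<Rightarrow> nat" where
  "even_vars n = 2 * n"

text \<open>The object variable 0 must stay fixed.\<close>

definition odd_vars :: "nat \<Rightarrow> nat" where
  "odd_vars n = (if n = 0 then 0 else 2 * n - 1)"

lemma inj_even_vars: "inj even_vars"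
  by (simp add: inj_def even_vars_def)

lemma inj_odd_vars: "inj odd_vars"
proof (rule injI)
  fix m n assume "odd_vars m = odd_vars n"
  then show "m = n" by (cases m; cases n) (simp_all add: odd_vars_def)
qed

text \<open>At odd positions \<open>Suc n div 2\<close> inverts \<open>odd_vars\<close>. The value
  \<open>d 0\<close> is lost, which is harmless since an instance overwrites the value of variable
  0.\<close>

definition merge :: "(nat \<Rightarrow> 'm) \<Rightarrow> (nat \<Rightarrow> 'm) \<Rightarrow> nat \<Rightarrow> 'm" where
  "merge c d n = (if even n then c (n div 2) else d (Suc n div 2))"

lemma instance_set_rename:
  assumes "inj \<pi>" "\<pi> 0 = 0"
  shows "instance_set M (rename \<pi> \<phi>) e = instance_set M \<phi> (\<lambda>n. e (\<pi> n))"
proof -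
  have "(e(0 := b)) (\<pi> n) = ((\<lambda>n. e (\<pi> n))(0 := b)) n" for b n
    using inj_eq[OF assms(1), of n 0] assms(2) by auto
  then have "(\<lambda>n. (e(0 := b)) (\<pi> n)) = (\<lambda>n. e (\<pi> n))(0 := b)" for b
    by blast
  then show ?thesis by (simp only: instance_set_def sat_rename[OF assms(1)])
qed

lemmas instance_set_rename_even = instance_set_rename[OF inj_even_vars]
  and instance_set_rename_odd = instance_set_rename[OF inj_odd_vars]

lemma instance_set_merge:
  "instance_set M (rename even_vars \<phi>) (merge c d) = instance_set M \<phi> c"
  "instance_set M (rename odd_vars \<phi>) (merge c d) = instance_set M \<phi> d"
proof -
  show "instance_set M (rename even_vars \<phi>) (merge c d) = instance_set M \<phi> c"
    by (subst instance_set_rename_even) (auto simp: merge_def even_vars_def intro: instance_set_cong)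
  show "instance_set M (rename odd_vars \<phi>) (merge c d) = instance_set M \<phi> d"
    by (subst instance_set_rename_odd) (auto simp: merge_def odd_vars_def intro!: instance_set_cong)
qed

lemma merge_assignments:
  "c \<in> assignments M \<Longrightarrow> d \<in> assignments M \<Longrightarrow> merge c d \<in> assignments M"
  by (auto simp: assignments_def merge_def)

lemma assignments_upd: "e \<in> assignments M \<Longrightarrow> b \<in> univ M \<Longrightarrow> e(n := b) \<in> assignments M"
  by (auto simp: assignments_def)

text \<open>Quantifying the object variable turns the equality of two instances into a condition on
  parameters, to which Los's theorem applies.\<close>

definition same_set :: "fm \<Rightarrow> fm \<Rightarrow> fm" where
  "same_set \<phi> \<psi> = Conj (Neg (Exists 0 (Conj \<phi> (Neg \<psi>)))) (Neg (Exists 0 (Conj (Neg \<phi>) \<psi>)))"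

lemma sat_same_set:
  "sat M e (same_set \<phi> \<psi>) \<longleftrightarrow> instance_set M \<phi> e = instance_set M \<psi> e"
  by (auto simp: same_set_def instance_set_def)

definition Disj :: "fm \<Rightarrow> fm \<Rightarrow> fm" where
  "Disj \<phi> \<psi> = Neg (Conj (Neg \<phi>) (Neg \<psi>))"

lemma instance_set_Disj: "instance_set M (Disj \<phi> \<psi>) e = instance_set M \<phi> e \<union> instance_set M \<psi> e"
  by (auto simp: Disj_def instance_set_def)

lemma instance_set_Neg: "instance_set M (Neg \<phi>) e = univ M - instance_set M \<phi> e"
  by (auto simp: instance_set_def)

definition bounded_pieces :: "'m struct \<Rightarrow> 'm rel \<Rightarrow> nat \<Rightarrow> fm \<Rightarrow> bool" where
  "bounded_pieces N r k \<phi> \<longleftrightarrow> (\<forall>e\<in>assignments N. union_of_convex (univ N) r k (instance_set N \<phi> e))"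

lemma bounded_pieces_rename:
  assumes "inj \<pi>" "\<pi> 0 = 0" "bounded_pieces N r k \<phi>"
  shows "bounded_pieces N r k (rename \<pi> \<phi>)"
  using assms(3) unfolding bounded_pieces_def instance_set_rename[OF assms(1,2)]
  by (simp add: assignments_def)

lemma bounded_pieces_Disj:
  "bounded_pieces N r k \<phi> \<Longrightarrow> bounded_pieces N r l \<psi> \<Longrightarrow> bounded_pieces N r (k + l) (Disj \<phi> \<psi>)"
  by (simp add: bounded_pieces_def instance_set_Disj union_of_convex_Un)

lemma bounded_pieces_Neg:
  "linear_order_on (univ N) r \<Longrightarrow> bounded_pieces N r k \<phi> \<Longrightarrow> bounded_pieces N r (Suc k) (Neg \<phi>)"
  by (simp add: bounded_pieces_def instance_set_Neg union_of_convex_compl)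

text \<open>The order lives on \<open>N\<close> but \<open>A\<close> is a subset of
  \<open>M\<close>, so the pieces of \<open>A\<close> itself cannot be counted. The induction
  records the shape of the combination as a formula; the same shape in \<open>N\<close> bounds the
  pieces there, uniformly in the parameters.\<close>

lemma boolean_combination_bounded_pieces:
  fixes M :: "'a struct" and N :: "'b struct"
  assumes r: "linear_order_on (univ N) r" and conv: "\<And>\<psi>. \<psi> \<in> \<Psi> \<Longrightarrow> bounded_pieces N r 1 \<psi>"
    and M: "univ M \<noteq> {}" and A: "A \<in> boolean_combinations (univ M) (instances M \<Psi>)"
  shows "\<exists>\<theta> d k. d \<in> assignments M \<and> A = instance_set M \<theta> d \<and> bounded_pieces N r k \<theta>"
  using A
proof induction
  case (basic B)
  then obtain \<psi> d where "\<psi> \<in> \<Psi>" "d \<in> assignments M" "B = instance_set M \<psi> d"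
    unfolding instances_def by blast
  then show ?case using conv[OF \<open>\<psi> \<in> \<Psi>\<close>] by blast
next
  case empty
  obtain a where "a \<in> univ M" using M by blast
  then have "(\<lambda>_. a) \<in> assignments M" by (simp add: assignments_def)
  moreover have "{} = instance_set M (Neg (Eq (Var 0) (Var 0))) (\<lambda>_. a)"
    by (simp add: instance_set_def)
  moreover have "bounded_pieces N r 0 (Neg (Eq (Var 0) (Var 0)))"
    by (simp add: bounded_pieces_def instance_set_def union_of_convex_empty)
  ultimately show ?case by blast
next
  case (compl A)
  then obtain \<theta> d k where "d \<in> assignments M" "A = instance_set M \<theta> d" "bounded_pieces N r k \<theta>"
    by blast
  then have "univ M - A = instance_set M (Neg \<theta>) d" "bounded_pieces N r (Suc k) (Neg \<theta>)"
    using bounded_pieces_Neg[OF r] by (simp_all add: instance_set_Neg)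
  then show ?case using \<open>d \<in> assignments M\<close> by blast
next
  case (union A B)
  then obtain \<theta> d k \<eta> d' l where 1: "d \<in> assignments M" "A = instance_set M \<theta> d" "bounded_pieces N r k \<theta>"
    and 2: "d' \<in> assignments M" "B = instance_set M \<eta> d'" "bounded_pieces N r l \<eta>" by blast
  let ?\<chi> = "Disj (rename even_vars \<theta>) (rename odd_vars \<eta>)"
  have "A \<union> B = instance_set M ?\<chi> (merge d d')"
    using 1 2 by (simp add: instance_set_Disj instance_set_merge)
  moreover have "bounded_pieces N r (k + l) ?\<chi>"
    using 1 2 by (intro bounded_pieces_Disj bounded_pieces_rename inj_even_vars inj_odd_vars)
      (simp_all add: even_vars_def odd_vars_def)
  ultimately show ?case using merge_assignments[OF 1(1) 2(1)] by blast
qed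

text \<open>
  If the numbers of convex pieces of the sets \<open>\<phi>(N; e)\<close> are unbounded, then an ultrapower of \<open>N\<close> has
  an instance of \<open>\<phi>\<close> that is no boolean combination of instances of \<open>\<Psi>\<close>, because the instances of
  a single formula built from \<open>\<Psi>\<close> have a bounded number of convex pieces in \<open>N\<close>.
\<close>

theorem VC_minimal_imp_convexly_orderable:
  fixes N :: "'m struct"
  assumes inf: "infinite (UNIV :: 'm set)" and vc: "VC_minimal TYPE('m) T"
    and N: "models N T" "countable (univ N)"
  shows "convexly_orderable N"
proof -
  obtain \<Psi> where \<Psi>: "directed_formulas TYPE('m) T \<Psi> \<and> (\<forall>M :: 'm struct. models M T \<longrightarrow>
      (\<forall>\<phi>. \<forall>e\<in>assignments M.
         instance_set M \<phi> e \<in> boolean_combinations (univ M) (instances M \<Psi>)))"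
    using vc[unfolded VC_minimal_def] ..
  have dir: "directed_family (instances M \<Psi>)" if "models M T" for M :: "'m struct"
    using \<Psi> that unfolding directed_formulas_def by simp
  have bc: "instance_set M \<phi> e \<in> boolean_combinations (univ M) (instances M \<Psi>)"
    if "models M T" "e \<in> assignments M" for M :: "'m struct" and \<phi> e
    using \<Psi> that by simp
  obtain r where r: "linear_order_on (univ N) r"
    and conv: "\<And>B. B \<in> instances N \<Psi> \<Longrightarrow> convex_subset (univ N) r B"
    using directed_family_convex_order[OF N(2) dir[OF N(1)]]
    by (auto simp: instances_def instance_set_def)
  have "\<exists>k. \<forall>e\<in>assignments N. union_of_convex (univ N) r k (instance_set N \<phi> e)" for \<phi>
  proof (rule ccontr)
    assume "\<not> ?thesis"
    then obtain e where e: "\<And>k. e k \<in> assignments N"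
      and bad: "\<And>k. \<not> union_of_convex (univ N) r k (instance_set N \<phi> (e k))"
      by metis
    \<comment> \<open>An ultrafilter below \<open>sequentially\<close> contains every tail, so the
      index eventually exceeds any fixed bound.\<close>
    obtain F where F: "F \<le> sequentially" "ultrafilter F"
      using ex_ultrafilter[of sequentially] by auto
    have strN: "is_struct N" using N(1) by (simp add: models_def)
    \<comment> \<open>For each variable the sequence of its values in the bad assignments enters the
      hull and becomes a parameter \<open>c n\<close> of \<open>M\<close>.\<close>
    have S: "countable (range (\<lambda>n k. e k n))" "\<forall>s\<in>range (\<lambda>n k. e k n). \<forall>i. s i \<in> univ N"
      using e by (auto simp: assignments_def)
    obtain M :: "'m struct" and g where M: "is_struct M"
      and g: "\<And>b i. b \<in> univ M \<Longrightarrow> g b i \<in> univ N"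
      and ex: "\<And>s. s \<in> range (\<lambda>n k. e k n) \<Longrightarrow> \<exists>b\<in>univ M. \<forall>\<^sub>F i in F. g b i = s i"
      and los: "\<And>e \<phi>. e \<in> assignments M \<Longrightarrow> sat M e \<phi> \<longleftrightarrow> (\<forall>\<^sub>F i in F. sat N (\<lambda>n. g (e n) i) \<phi>)"
      by (rule skolem_ultrapower[OF inf strN F(2) S]) blast
    have g_assign: "(\<lambda>n. g (d n) i) \<in> assignments N" if "d \<in> assignments M" for d i
      using that g by (simp add: assignments_def)
    have "models M T"
      using M N(1) los g_assign by (auto simp: models_def)
    obtain c where c: "\<And>n. c n \<in> univ M" "\<And>n. \<forall>\<^sub>F i in F. g (c n) i = e i n"
      using choice[of "\<lambda>n b. b \<in> univ M \<and> (\<forall>\<^sub>F i in F. g b i = e i n)"] ex[OF rangeI] by blast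
    then have c_assign: "c \<in> assignments M" by (simp add: assignments_def)
    have "\<exists>\<theta> d k. d \<in> assignments M \<and> instance_set M \<phi> c = instance_set M \<theta> d \<and> bounded_pieces N r k \<theta>"
    proof (rule boolean_combination_bounded_pieces[OF r])
      show "bounded_pieces N r 1 \<psi>" if "\<psi> \<in> \<Psi>" for \<psi>
        unfolding bounded_pieces_def
        by (intro ballI union_of_convex_single conv) (use that in \<open>auto simp: instances_def\<close>)
      show "univ M \<noteq> {}" using M by (simp add: is_struct_def)
      show "instance_set M \<phi> c \<in> boolean_combinations (univ M) (instances M \<Psi>)"
        by (rule bc[OF \<open>models M T\<close> c_assign])
    qed
    then obtain \<theta> d k where d: "d \<in> assignments M" "instance_set M \<phi> c = instance_set M \<theta> d"
      and k: "\<And>e. e \<in> assignments N \<Longrightarrow> union_of_convex (univ N) r k (instance_set N \<theta> e)"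
      unfolding bounded_pieces_def by blast
    have "sat M (merge c d) (same_set (rename even_vars \<phi>) (rename odd_vars \<theta>))"
      using d(2) by (simp add: sat_same_set instance_set_merge)
    then have "\<forall>\<^sub>F i in F. sat N (\<lambda>n. g (merge c d n) i) (same_set (rename even_vars \<phi>) (rename odd_vars \<theta>))"
      by (simp only: los[OF merge_assignments[OF c_assign d(1)]])
    moreover have "(\<lambda>n. g (merge c d n) i) = merge (\<lambda>n. g (c n) i) (\<lambda>n. g (d n) i)" for i
      by (auto simp: merge_def)
    ultimately have "\<forall>\<^sub>F i in F. instance_set N \<phi> (\<lambda>n. g (c n) i) = instance_set N \<theta> (\<lambda>n. g (d n) i)"
      by (simp add: sat_same_set instance_set_merge)
    \<comment> \<open>Each parameter agrees eventually; finitely many free variables agree at a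
      common index.\<close>
    moreover have "\<forall>\<^sub>F i in F. \<forall>n\<in>free_vars \<phi>. g (c n) i = e i n"
      using c(2) by (simp add: eventually_ball_finite_distrib)
    moreover have "\<forall>\<^sub>F i in F. k \<le> i"
      by (rule filter_leD[OF F(1) eventually_ge_at_top])
    ultimately have "\<forall>\<^sub>F i in F. False"
    proof eventually_elim
      case (elim i)
      have "instance_set N \<phi> (e i) = instance_set N \<phi> (\<lambda>n. g (c n) i)"
        by (rule instance_set_cong) (use elim in simp)
      then have "union_of_convex (univ N) r k (instance_set N \<phi> (e i))"
        using k[OF g_assign[OF d(1)]] elim by simp
      then show False using bad union_of_convex_mono[OF _ elim(3)] by blast
    qed
    then show False using F(2) by (simp add: ultrafilter_def eventually_False)
  qed
  then show ?thesis using r by (auto simp: convexly_orderable_def)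
qed

section \<open>Alternating chains\<close>

text \<open>
  An increasing chain \<open>z 0, \<dots>, z n\<close> that leaves and enters \<open>S (z 0)\<close> alternately and whose convex
  hull lies in the ball \<open>B c q\<close> is built by induction on \<open>n\<close>: among \<open>l + 1\<close> disjoint subballs, two
  must have chains that start in the same convex piece of \<open>B c q\<close>; the start of the upper one then
  lies above the whole chain in the lower one and extends it.
\<close>

lemma no_alternating_balls:
  fixes X :: "'m set" and B :: "'m \<Rightarrow> nat \<Rightarrow> 'm set" and S :: "'m \<Rightarrow> 'm set"
  assumes lin: "linear_order_on X R" and ne: "X \<noteq> {}"
    and S: "\<And>a. a \<in> X \<Longrightarrow> union_of_convex X R k (S a)"
    and B: "\<And>c q. c \<in> X \<Longrightarrow> union_of_convex X R l (B c q)"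
    and center: "\<And>c q. c \<in> X \<Longrightarrow> c \<in> B c q"
    and subballs: "\<And>c q \<epsilon>. c \<in> X \<Longrightarrow> \<exists>d. (\<forall>i\<le>l. d i \<in> X \<and> B (d i) (Suc q) \<subseteq> B c q) \<and>
      (\<forall>i\<le>l. \<forall>j\<le>l. i \<noteq> j \<longrightarrow> B (d i) (Suc q) \<inter> B (d j) (Suc q) = {} \<and>
         (\<forall>a\<in>B (d i) (Suc q). \<forall>b\<in>B (d j) (Suc q). b \<in> S a \<longleftrightarrow> \<epsilon>))"
  shows False
proof -
  have trans: "(x, z) \<in> R" if "(x, y) \<in> R" "(y, z) \<in> R" for x y z
    using lin that by (meson linear_order_on_def partial_order_on_def preorder_on_def transD)
  have antisym: "x = y" if "(x, y) \<in> R" "(y, x) \<in> R" for x y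
    using lin that by (meson linear_order_on_def partial_order_on_def antisymD)
  have refl: "(x, x) \<in> R" if "x \<in> X" for x
    using lin that by (meson linear_order_on_def partial_order_on_def preorder_on_def refl_onD)
  have total: "(x, y) \<in> R \<or> (y, x) \<in> R" if "x \<in> X" "y \<in> X" for x y
    using lin that refl by (metis linear_order_on_def total_on_def)
  define chain where "chain c q n z \<longleftrightarrow> (\<forall>i\<le>n. z i \<in> X) \<and> (\<forall>i j. i \<le> j \<and> j \<le> n \<longrightarrow> (z i, z j) \<in> R) \<and>
      (\<forall>y\<in>X. (z 0, y) \<in> R \<and> (y, z n) \<in> R \<longrightarrow> y \<in> B c q) \<and>
      (\<forall>i. 0 < i \<and> i \<le> n \<longrightarrow> (z i \<in> S (z 0) \<longleftrightarrow> even i))" for c q n and z :: "nat \<Rightarrow> 'm"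
  have ex_chain: "\<exists>z. chain c q n z" if "c \<in> X" for c q n
    using that
  proof (induction n arbitrary: c q)
    case 0
    have "y \<in> B c q" if "(c, y) \<in> R" "(y, c) \<in> R" for y
      using antisym[OF that] center[OF 0] by simp
    then show ?case using refl[OF 0] 0 by (intro exI[of _ "\<lambda>_. c"]) (auto simp: chain_def)
  next
    case (Suc n)
    \<comment> \<open>This level is coloured by the parity prescribed for the new top index
      \<open>Suc n\<close>.\<close>
    obtain d where D: "(\<forall>i\<le>l. d i \<in> X \<and> B (d i) (Suc q) \<subseteq> B c q) \<and>
      (\<forall>i\<le>l. \<forall>j\<le>l. i \<noteq> j \<longrightarrow> B (d i) (Suc q) \<inter> B (d j) (Suc q) = {} \<and>
         (\<forall>a\<in>B (d i) (Suc q). \<forall>b\<in>B (d j) (Suc q). b \<in> S a \<longleftrightarrow> even (Suc n)))"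
      using subballs[OF Suc.prems, of q "even (Suc n)"] ..
    have d: "d i \<in> X" "B (d i) (Suc q) \<subseteq> B c q" if "i \<le> l" for i
      using D that by simp_all
    have disj: "B (d i) (Suc q) \<inter> B (d j) (Suc q) = {}" if "i \<le> l" "j \<le> l" "i \<noteq> j" for i j
      using D that by simp
    have cls: "b \<in> S a \<longleftrightarrow> even (Suc n)"
      if "i \<le> l" "j \<le> l" "i \<noteq> j" "a \<in> B (d i) (Suc q)" "b \<in> B (d j) (Suc q)" for i j a b
      by (rule D[THEN conjunct2, rule_format, THEN conjunct2, rule_format]) (use that in simp_all)
    have "\<exists>z. \<forall>i. i \<le> l \<longrightarrow> chain (d i) (Suc q) n (z i)"
      by (rule choice) (use Suc.IH d(1) in blast)
    then obtain z where z: "\<And>i. i \<le> l \<Longrightarrow> chain (d i) (Suc q) n (z i)" by blast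
    have zX: "z i j \<in> X" if "i \<le> l" "j \<le> n" for i j
      using z[OF that(1)] that(2) unfolding chain_def by blast
    have start: "z i 0 \<in> B (d i) (Suc q)" if "i \<le> l" for i
      using z[OF that] refl[OF zX[OF that]] zX[OF that] unfolding chain_def by blast
    obtain \<C> where C: "finite \<C>" "card \<C> \<le> l" "\<And>C. C \<in> \<C> \<Longrightarrow> convex_subset X R C" "B c q = \<Union>\<C>"
      using B[OF Suc.prems, of q] unfolding union_of_convex_def by blast
    have "\<exists>f. \<forall>i. i \<le> l \<longrightarrow> f i \<in> \<C> \<and> z i 0 \<in> f i"
      by (rule choice) (use start d(2) C(4) in blast)
    then obtain f where f: "\<And>i. i \<le> l \<Longrightarrow> f i \<in> \<C> \<and> z i 0 \<in> f i" by blast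
    have "\<not> inj_on f {..l}"
      using card_inj_on_le[of f "{..l}" \<C>] f C(1,2) by auto
    then obtain i0 j0 where ij0: "i0 \<le> l" "j0 \<le> l" "i0 \<noteq> j0" "f i0 = f j0"
      unfolding inj_on_def by auto
    have "(z i0 0, z j0 0) \<in> R \<or> (z j0 0, z i0 0) \<in> R"
      by (rule total[OF zX[OF ij0(1)] zX[OF ij0(2)]]) simp_all
    then obtain i j where ij: "i \<le> l" "j \<le> l" "i \<noteq> j" "f i = f j" "(z i 0, z j 0) \<in> R"
      using ij0 ij0(3,4)[symmetric] by blast
    \<comment> \<open>If \<open>z j 0\<close> lay below \<open>z i n\<close>, it would be in the
      convex hull of the lower chain, hence in the ball around \<open>d i\<close>, which is disjoint
      from its own.\<close>
    have above: "(z i m, z j 0) \<in> R" if "m \<le> n" for m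
    proof -
      have "\<not> (z j 0, z i n) \<in> R"
      proof
        assume "(z j 0, z i n) \<in> R"
        then have "z j 0 \<in> B (d i) (Suc q)"
          using z[OF ij(1)] ij(5) zX[OF ij(2)] unfolding chain_def by blast
        then show False using disj[OF ij(1-3)] start[OF ij(2)] by blast
      qed
      then have "(z i n, z j 0) \<in> R" using total[OF zX[OF ij(1), of n] zX[OF ij(2), of 0]] by simp
      moreover have "(z i m, z i n) \<in> R" using z[OF ij(1)] that unfolding chain_def by blast
      ultimately show ?thesis by (rule trans[rotated])
    qed
    let ?z = "(z i)(Suc n := z j 0)"
    have "chain c q (Suc n) ?z"
      unfolding chain_def
    proof (intro conjI allI impI ballI)
      show "?z m \<in> X" if "m \<le> Suc n" for m
        using zX ij(1,2) that by (simp add: le_Suc_eq) blast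
      show "(?z m, ?z m') \<in> R" if "m \<le> m' \<and> m' \<le> Suc n" for m m'
      proof (cases "m' = Suc n")
        case True
        then show ?thesis using that above refl[OF zX[OF ij(2)]] by (cases "m = Suc n") auto
      next
        case False
        then show ?thesis using that z[OF ij(1)] unfolding chain_def by auto
      qed
      \<comment> \<open>The new hull runs from \<open>z i 0\<close> to \<open>z j 0\<close>, both of
        which lie in the convex piece \<open>f i\<close> of the ball.\<close>
      show "y \<in> B c q" if "y \<in> X" "(?z 0, y) \<in> R \<and> (y, ?z (Suc n)) \<in> R" for y
      proof -
        have "convex_subset X R (f i)" "z i 0 \<in> f i" "z j 0 \<in> f i"
          using C(3) f[OF ij(1)] f[OF ij(2)] ij(4) by simp_all
        moreover have "(z i 0, y) \<in> R" "(y, z j 0) \<in> R" using that(2) by simp_all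
        ultimately have "y \<in> f i" using that(1) unfolding convex_subset_def by blast
        then show ?thesis using f[OF ij(1)] C(4) by blast
      qed
      show "?z m \<in> S (?z 0) \<longleftrightarrow> even m" if "0 < m \<and> m \<le> Suc n" for m
      proof (cases "m = Suc n")
        case True
        then show ?thesis using cls[OF ij(1-3) start[OF ij(1)] start[OF ij(2)]] by simp
      next
        case False
        then have "m \<le> n" "0 < m" using that by auto
        then have "z i m \<in> S (z i 0) \<longleftrightarrow> even m" using z[OF ij(1)] unfolding chain_def by blast
        then show ?thesis using False by simp
      qed
    qed
    then show ?case by blast
  qed
  obtain c where "c \<in> X" using ne by blast
  \<comment> \<open>The indices 2, 4, ..., \<open>2 * k + 2\<close> give \<open>k + 1\<close> points
    of \<open>S (z 0)\<close>, consecutive ones being separated by a point outside; \<open>k\<close>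
    convex pieces cannot hold them.\<close>
  then obtain z where z: "chain c 0 (2 * k + 2) z" using ex_chain by blast
  then have zX: "z i \<in> X" if "i \<le> 2 * k + 2" for i using that unfolding chain_def by blast
  have zS: "z i \<in> S (z 0) \<longleftrightarrow> even i" if "0 < i" "i \<le> 2 * k + 2" for i
    using z that unfolding chain_def by blast
  have zR: "(z i, z j) \<in> R" if "i \<le> j" "j \<le> 2 * k + 2" for i j
    using z that unfolding chain_def by blast
  obtain \<C> where C: "finite \<C>" "card \<C> \<le> k" "\<And>C. C \<in> \<C> \<Longrightarrow> convex_subset X R C" "S (z 0) = \<Union>\<C>"
    using S[OF zX[of 0]] unfolding union_of_convex_def by auto
  have even_in: "z (2 * i + 2) \<in> S (z 0)" if "i \<le> k" for i
    using zS[of "2 * i + 2"] that by simp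
  have "\<exists>f. \<forall>i. i \<le> k \<longrightarrow> f i \<in> \<C> \<and> z (2 * i + 2) \<in> f i"
    by (rule choice) (use even_in C(4) in blast)
  then obtain f where f: "\<And>i. i \<le> k \<Longrightarrow> f i \<in> \<C> \<and> z (2 * i + 2) \<in> f i" by blast
  have "inj_on f {..k}"
  proof (rule linorder_inj_onI)
    fix i j assume "i < j" and ij: "i \<in> {..k}" "j \<in> {..k}"
    show "f i \<noteq> f j"
    proof
      assume eq: "f i = f j"
      have "convex_subset X R (f i)" "z (2 * i + 2) \<in> f i" "z (2 * j + 2) \<in> f i"
        using C(3) f[of i] f[of j] ij eq by simp_all
      moreover have "(z (2 * i + 2), z (2 * i + 3)) \<in> R" "(z (2 * i + 3), z (2 * j + 2)) \<in> R"
        "z (2 * i + 3) \<in> X"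
        using \<open>i < j\<close> ij by (simp_all add: zR zX)
      ultimately have "z (2 * i + 3) \<in> f i" unfolding convex_subset_def by blast
      then have "z (2 * i + 3) \<in> S (z 0)" using f[of i] ij C(4) by auto
      then show False using zS[of "2 * i + 3"] \<open>i < j\<close> ij by simp
    qed
  qed auto
  then show False
    using card_inj_on_le[of f "{..k}" \<C>] f C(1,2) by auto
qed

section \<open>Valued fields\<close>

abbreviation nmult :: "nat \<Rightarrow> 'g::linordered_ab_group_add \<Rightarrow> 'g" where
  "nmult n g \<equiv> (\<Sum>i<n. g)"

lemma nmult_add: "nmult (m + n) g = nmult m g + nmult n g"
  by (induction n) (simp_all add: add.assoc)

lemma nmult_mult: "nmult (m * n) g = nmult m (nmult n g)"
  by (induction m) (simp_all add: nmult_add add.commute)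

lemma nmult_less:
  assumes "g > 0" "m < n"
  shows "nmult m g < nmult n g"
proof -
  have "nmult k g \<ge> 0" for k using assms by (intro sum_nonneg) simp
  then have "nmult (Suc k) g > 0" for k using assms by (simp add: add_nonneg_pos)
  moreover obtain k where "n = m + Suc k" using assms less_imp_Suc_add by auto
  ultimately show ?thesis by (simp only: nmult_add less_add_same_cancel1)
qed

lemma nmult_mono: "g > 0 \<Longrightarrow> m \<le> n \<Longrightarrow> nmult m g \<le> nmult n g"
  using nmult_less[of g m n] by (cases "m = n") auto

text \<open>This multiple of \<open>g\<close> differs from \<open>g\<close> by an element of the
  subgroup n\<Gamma>, so it lies in the same coset.\<close>

lemma nmult_Suc_in_range:
  assumes "g \<notin> range (nmult n)"
  shows "nmult (Suc (n * r)) g \<notin> range (nmult n)"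
proof
  assume "nmult (Suc (n * r)) g \<in> range (nmult n)"
  then obtain x where "nmult n (nmult r g) + g = nmult n x" by (auto simp: nmult_mult)
  then have "g = nmult n (x - nmult r g)" by (simp add: sum_subtractf algebra_simps)
  then show False using assms by blast
qed

text \<open>The range is closed under negation, so \<open>g\<close> may be replaced by
  \<open>- g\<close>. Positivity makes balls shrink when their radii run through growing multiples
  of \<open>g\<close>.\<close>

lemma not_divisible_positive:
  assumes "\<not> divisible_group TYPE('g::linordered_ab_group_add)"
  obtains n and g :: "'g::linordered_ab_group_add" where "n > 0" "g > 0" "g \<notin> range (nmult n)"
proof -
  obtain n and g :: 'g where n: "n \<ge> 1" and g: "g \<notin> range (nmult n)"
    using assms unfolding divisible_group_def by blast
  have neg: "- g \<notin> range (nmult n)"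
  proof
    assume "- g \<in> range (nmult n)"
    then obtain x where "- g = nmult n x" by blast
    then have "g = nmult n (- x)" by (simp add: sum_negf) (metis minus_minus)
    then show False using g by blast
  qed
  have "g \<noteq> 0"
  proof
    assume "g = 0"
    then have "g = nmult n 0" by simp
    then show False using g by blast
  qed
  then consider "g > 0" | "- g > 0" by (metis neg_0_less_iff_less linorder_neqE)
  then show ?thesis
  proof cases
    case 1
    show ?thesis by (rule that[OF _ 1 g]) (use n in simp)
  next
    case 2
    show ?thesis by (rule that[OF _ 2 neg]) (use n in simp)
  qed
qed

context valued_field
begin

lemma v_one: "v \<one> = Fin 0"
  using v_mult[of \<one> \<one>] v_range[of \<one>] v_infinity[of \<one>] by (cases "v \<one>") auto

text \<open>The square is 1, so twice the value is 0, and an ordered group has no torsion.\<close>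

lemma v_minus_one: "v (\<ominus> \<one>) = Fin 0"
  using v_mult[of "\<ominus> \<one>" "\<ominus> \<one>"] v_range[of "\<ominus> \<one>"] v_one
  by (cases "v (\<ominus> \<one>)") (auto simp: l_minus r_minus)

lemma v_uminus: "x \<in> carrier K \<Longrightarrow> v (\<ominus> x) = v x"
  using v_mult[of "\<ominus> \<one>" x] v_minus_one
  by (cases "v x") (auto simp: l_minus)

text \<open>A reversed distance: closer points have larger \<delta>, and a ball is given by a lower
  bound.\<close>

definition \<delta> :: "'a \<Rightarrow> 'a \<Rightarrow> 'g extended" where
  "\<delta> x y = v (x \<ominus> y)"

lemma \<delta>_self: "x \<in> carrier K \<Longrightarrow> \<delta> x x = \<infinity>"
  using v_infinity[of "x \<ominus> x"] by (simp add: \<delta>_def minus_eq r_neg)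

lemma \<delta>_zero: "x \<in> carrier K \<Longrightarrow> \<delta> x \<zero> = v x"
  by (simp add: \<delta>_def minus_eq)

lemma \<delta>_commute:
  assumes "x \<in> carrier K" "y \<in> carrier K"
  shows "\<delta> x y = \<delta> y x"
proof -
  have "x \<ominus> y = \<ominus> (y \<ominus> x)" using assms by algebra
  then show ?thesis using assms by (simp add: \<delta>_def v_uminus)
qed

lemma \<delta>_translate:
  assumes "x \<in> carrier K" "y \<in> carrier K" "z \<in> carrier K"
  shows "\<delta> (z \<oplus> x) (z \<oplus> y) = \<delta> x y"
proof -
  have "(z \<oplus> x) \<ominus> (z \<oplus> y) = x \<ominus> y" using assms by algebra
  then show ?thesis by (simp add: \<delta>_def)
qed

lemma \<delta>_ultrametric:
  assumes "x \<in> carrier K" "y \<in> carrier K" "z \<in> carrier K"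
  shows "min (\<delta> x y) (\<delta> y z) \<le> \<delta> x z"
proof -
  have "(x \<ominus> y) \<oplus> (y \<ominus> z) = x \<ominus> z" using assms by algebra
  then show ?thesis using v_add[of "x \<ominus> y" "y \<ominus> z"] assms by (simp add: \<delta>_def)
qed

text \<open>The inequality through \<open>y\<close> bounds \<open>\<delta> x z\<close> from below.
  The one through \<open>z\<close> bounds \<open>min (\<delta> x z) (\<delta> z y)\<close> by
  \<open>\<delta> x y\<close>, and \<open>\<delta> z y\<close> is too large to be this
  minimum.\<close>

lemma \<delta>_isosceles:
  assumes "x \<in> carrier K" "y \<in> carrier K" "z \<in> carrier K" "\<delta> x y < \<delta> y z"
  shows "\<delta> x z = \<delta> x y"
  using \<delta>_ultrametric[of x y z] \<delta>_ultrametric[of x z y] \<delta>_commute[of y z] assms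
  by (auto simp: min_def split: if_splits)

lemma v_pow:
  assumes "x \<in> carrier K" "v x = Fin g"
  shows "v (x [^] n) = Fin (nmult n g)"
  using assms by (induction n) (simp_all add: v_one v_mult add.commute)

text \<open>Powers make n\<Gamma> accessible to formulas about \<open>K\<close>. Since
  \<open>n > 0\<close>, the power of zero has infinite value, so a \<open>z\<close> as on the left
  is nonzero.\<close>

lemma v_pow_range:
  assumes "n > 0"
  shows "(\<exists>z\<in>carrier K. v (z [^] n) = Fin g) \<longleftrightarrow> g \<in> range (nmult n)"
proof
  assume "\<exists>z\<in>carrier K. v (z [^] n) = Fin g"
  then obtain z where z: "z \<in> carrier K" "v (z [^] n) = Fin g" by blast
  have "v (\<zero> [^] n) = \<infinity>" using assms v_infinity by (simp add: nat_pow_zero)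
  then have "z \<noteq> \<zero>" using z by auto
  then obtain x where "v z = Fin x" using z v_range[of z] v_infinity[of z] by (cases "v z") auto
  then show "g \<in> range (nmult n)" using v_pow[OF z(1), of x n] z(2) by auto
next
  assume "g \<in> range (nmult n)"
  then obtain x where x: "g = nmult n x" by blast
  obtain z where "z \<in> carrier K" "v z = Fin x" using v_onto by blast
  then show "\<exists>z\<in>carrier K. v (z [^] n) = Fin g" using v_pow[of z x n] x by blast
qed

text \<open>The lower of two powers of an element of positive value has the smaller value and
  determines that of the difference.\<close>

lemma \<delta>_powers:
  assumes "x \<in> carrier K" "v x = Fin g" "g > 0" "c \<in> carrier K" "i \<noteq> j"
  shows "\<delta> (c \<oplus> x [^] i) (c \<oplus> x [^] j) = Fin (nmult (min i j) g)"
proof -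
  have lt: "\<delta> (x [^] i) (x [^] j) = Fin (nmult i g)" if "i < j" for i j
  proof -
    have "\<delta> (x [^] i) \<zero> < \<delta> \<zero> (x [^] j)"
      using nmult_less[OF assms(3) that] assms(1,2) \<delta>_commute[of "\<zero>" "x [^] j"]
      by (simp add: \<delta>_zero v_pow)
    then show ?thesis using \<delta>_isosceles[of "x [^] i" "\<zero>" "x [^] j"] assms(1,2)
      by (simp add: \<delta>_zero v_pow)
  qed
  show ?thesis
  proof (cases "i < j")
    case True
    then show ?thesis using lt[OF True] assms by (simp add: \<delta>_translate)
  next
    case False
    then have "j < i" using assms by simp
    then show ?thesis using lt[of j i] \<delta>_commute[of "x [^] i" "x [^] j"] assms
      by (simp add: \<delta>_translate)
  qed
qed

lemma \<delta>_subballs: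
  assumes "a \<in> carrier K" "b \<in> carrier K" "x \<in> carrier K" "y \<in> carrier K"
    and "\<delta> x y < \<delta> a x" "\<delta> x y < \<delta> b y"
  shows "\<delta> b a = \<delta> x y"
proof -
  have "\<delta> y x = \<delta> x y" "\<delta> x a = \<delta> a x" "\<delta> y b = \<delta> b y" using \<delta>_commute assms by auto
  then have 1: "\<delta> y a = \<delta> x y" using \<delta>_isosceles[of y x a] assms by simp
  then have "\<delta> a y = \<delta> x y" using \<delta>_commute[of a y] assms by simp
  then have "\<delta> a b = \<delta> x y" using \<delta>_isosceles[of a y b] \<open>\<delta> y b = \<delta> b y\<close> assms by simp
  then show ?thesis using \<delta>_commute[of a b] assms by simp
qed

end

section \<open>Balls and value cosets as instances of formulas\<close>

text \<open>Variable 1 is the centre and the value of variable 2 the radius. The language has no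
  subtraction, so the difference is quantified as variable 3.\<close>

definition ball_fm :: fm where
  "ball_fm = Exists 3 (Conj (Eq (Var 0) (Add (Var 1) (Var 3))) (Divides (Var 2) (Var 3)))"

text \<open>No term denotes 1, so exponents start at 1: \<open>pow_tm t n\<close> stands for the
  power with exponent \<open>n + 1\<close>.\<close>

fun pow_tm :: "tm \<Rightarrow> nat \<Rightarrow> tm" where
  "pow_tm t 0 = t"
| "pow_tm t (Suc n) = Mul (pow_tm t n) t"

text \<open>Mutual divisibility expresses equality of values: the difference from the centre has a
  value in (n+1)\<Gamma> or is zero.\<close>

definition coset_fm :: "nat \<Rightarrow> fm" where
  "coset_fm n = Exists 3 (Exists 4 (Conj (Eq (Var 0) (Add (Var 1) (Var 3)))
     (Conj (Divides (Var 3) (pow_tm (Var 4) n)) (Divides (pow_tm (Var 4) n) (Var 3)))))"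

definition elementary_embedding :: "('m \<Rightarrow> 'a) \<Rightarrow> 'm struct \<Rightarrow> 'a struct \<Rightarrow> bool" where
  "elementary_embedding h M N \<longleftrightarrow> is_struct M \<and> h ` univ M \<subseteq> univ N \<and>
     (\<forall>\<phi>. \<forall>e\<in>assignments M. sat M e \<phi> \<longleftrightarrow> sat N (\<lambda>n. h (e n)) \<phi>)"

lemma elementary_embedding_add:
  assumes "elementary_embedding h M N" "a \<in> univ M" "b \<in> univ M"
  shows "h (add_op M a b) = add_op N (h a) (h b)"
proof -
  let ?e = "(\<lambda>_. a)(1 := b, 2 := add_op M a b)" and ?\<phi> = "Eq (Var 2) (Add (Var 0) (Var 1))"
  have "?e \<in> assignments M"
    using assms by (auto simp: elementary_embedding_def is_struct_def assignments_def)
  moreover have "sat M ?e ?\<phi>" by simp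
  ultimately have "sat N (\<lambda>n. h (?e n)) ?\<phi>" using assms(1) unfolding elementary_embedding_def by blast
  then show ?thesis by simp
qed

lemma elementary_embedding_mul:
  assumes "elementary_embedding h M N" "a \<in> univ M" "b \<in> univ M"
  shows "h (mul_op M a b) = mul_op N (h a) (h b)"
proof -
  let ?e = "(\<lambda>_. a)(1 := b, 2 := mul_op M a b)" and ?\<phi> = "Eq (Var 2) (Mul (Var 0) (Var 1))"
  have "?e \<in> assignments M"
    using assms by (auto simp: elementary_embedding_def is_struct_def assignments_def)
  moreover have "sat M ?e ?\<phi>" by simp
  ultimately have "sat N (\<lambda>n. h (?e n)) ?\<phi>" using assms(1) unfolding elementary_embedding_def by blast
  then show ?thesis by simp
qed

lemma elementary_embedding_models:
  assumes "elementary_embedding h M N"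
  shows "models M (Th N)"
proof -
  have "(\<lambda>n. h (e n)) \<in> assignments N" if "e \<in> assignments M" for e
    using assms that by (auto simp: elementary_embedding_def assignments_def)
  then show ?thesis using assms by (auto simp: models_def Th_def elementary_embedding_def)
qed

lemma elementary_embedding_instance_set:
  assumes "elementary_embedding h M N" "e \<in> assignments M"
  shows "instance_set M \<phi> e = {b \<in> univ M. sat N ((\<lambda>n. h (e n))(0 := h b)) \<phi>}"
proof -
  have "(\<lambda>n. h ((e(0 := b)) n)) = (\<lambda>n. h (e n))(0 := h b)" for b by auto
  then have "sat M (e(0 := b)) \<phi> \<longleftrightarrow> sat N ((\<lambda>n. h (e n))(0 := h b)) \<phi>" if "b \<in> univ M" for b
    using assms(1) assignments_upd[OF assms(2) that, of 0] unfolding elementary_embedding_def by metis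
  then show ?thesis by (auto simp: instance_set_def)
qed

text \<open>A power over a one-point index set with its principal ultrafilter is a copy of
  \<open>N\<close>, so \<open>skolem_ultrapower\<close> returns a countable elementary
  substructure.\<close>

lemma Loewenheim_Skolem:
  fixes N :: "'a struct"
  assumes inf: "infinite (UNIV :: 'm set)" and N: "is_struct N" and S: "countable S" "S \<subseteq> univ N"
  obtains M :: "'m struct" and h where "elementary_embedding h M N" "countable (univ M)"
    "S \<subseteq> h ` univ M"
proof -
  have F: "ultrafilter (principal {()})"
    by (auto simp: ultrafilter_def eventually_principal principal_eq_bot_iff)
  have S': "countable ((\<lambda>s (_ :: unit). s) ` S)" "\<forall>s\<in>(\<lambda>s (_ :: unit). s) ` S. \<forall>i. s i \<in> univ N"
    using S by auto
  obtain M :: "'m struct" and g where M: "is_struct M" "countable (univ M)"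
    and g: "\<And>b i. b \<in> univ M \<Longrightarrow> g b i \<in> univ N"
    and ex: "\<And>s. s \<in> (\<lambda>s (_ :: unit). s) ` S \<Longrightarrow> \<exists>b\<in>univ M. \<forall>\<^sub>F i in principal {()}. g b i = s i"
    and los: "\<And>e \<phi>. e \<in> assignments M \<Longrightarrow> sat M e \<phi> \<longleftrightarrow> (\<forall>\<^sub>F i in principal {()}. sat N (\<lambda>n. g (e n) i) \<phi>)"
    by (rule skolem_ultrapower[OF inf N F S']) blast
  show ?thesis
  proof (rule that[of "\<lambda>b. g b ()" M])
    show "elementary_embedding (\<lambda>b. g b ()) M N"
      using M g los by (auto simp: elementary_embedding_def eventually_principal)
    show "S \<subseteq> (\<lambda>b. g b ()) ` univ M"
    proof
      fix s assume "s \<in> S"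
      then obtain b where "b \<in> univ M" "g b () = s"
        using ex[of "\<lambda>_. s"] by (auto simp: eventually_principal)
      then show "s \<in> (\<lambda>b. g b ()) ` univ M" by blast
    qed
  qed (rule M(2))
qed

context valued_field
begin

lemma tm_val_pow_tm:
  assumes "tm_val (valued_field_struct K v) e t \<in> carrier K"
  shows "tm_val (valued_field_struct K v) e (pow_tm t n) =
    tm_val (valued_field_struct K v) e t [^] Suc n"
  using assms by (induction n) (simp_all add: valued_field_struct_def)

lemma ex_difference:
  assumes "x \<in> carrier K" "y \<in> carrier K"
  shows "(\<exists>w\<in>carrier K. x = y \<oplus> w \<and> P (v w)) \<longleftrightarrow> P (\<delta> x y)"
proof -
  have "x = y \<oplus> w \<longleftrightarrow> w = x \<ominus> y" if "w \<in> carrier K" for w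
  proof
    show "w = x \<ominus> y" if "x = y \<oplus> w" using that assms \<open>w \<in> carrier K\<close> by algebra
    show "x = y \<oplus> w" if "w = x \<ominus> y" using that assms by algebra
  qed
  then show ?thesis using assms by (auto simp: \<delta>_def)
qed

lemma instance_set_ball_fm:
  assumes "elementary_embedding h M (valued_field_struct K v)" "e \<in> assignments M"
  shows "instance_set M ball_fm e = {b \<in> univ M. v (h (e 2)) \<le> \<delta> (h b) (h (e 1))}"
proof -
  have "h b \<in> carrier K" if "b \<in> univ M" for b
    using assms that by (auto simp: elementary_embedding_def valued_field_struct_def)
  moreover have "e n \<in> univ M" for n using assms by (simp add: assignments_def)
  ultimately have "(\<exists>w\<in>carrier K. h b = h (e 1) \<oplus> w \<and> v (h (e 2)) \<le> v w) \<longleftrightarrow>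
      v (h (e 2)) \<le> \<delta> (h b) (h (e 1))" if "b \<in> univ M" for b
    using ex_difference[of "h b" "h (e 1)" "\<lambda>u. v (h (e 2)) \<le> u"] that by simp
  moreover have "sat (valued_field_struct K v) ((\<lambda>n. h (e n))(0 := h b)) ball_fm \<longleftrightarrow>
      (\<exists>w\<in>carrier K. h b = h (e 1) \<oplus> w \<and> v (h (e 2)) \<le> v w)" for b
    by (simp add: valued_field_struct_def ball_fm_def)
  ultimately show ?thesis
    unfolding elementary_embedding_instance_set[OF assms] by auto
qed

text \<open>Truth is carried over to \<open>K\<close> before it is evaluated, so \<open>z\<close>
  ranges over the whole field although \<open>b\<close> comes from \<open>M\<close>.\<close>

lemma instance_set_coset_fm:
  assumes "elementary_embedding h M (valued_field_struct K v)" "e \<in> assignments M"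
  shows "instance_set M (coset_fm n) e =
    {b \<in> univ M. \<exists>z\<in>carrier K. v (z [^] Suc n) = \<delta> (h b) (h (e 1))}"
proof -
  have "h b \<in> carrier K" if "b \<in> univ M" for b
    using assms that by (auto simp: elementary_embedding_def valued_field_struct_def)
  moreover have "e n \<in> univ M" for n using assms by (simp add: assignments_def)
  ultimately have "(\<exists>w\<in>carrier K. h b = h (e 1) \<oplus> w \<and> (\<exists>z\<in>carrier K. v (z [^] Suc n) = v w)) \<longleftrightarrow>
      (\<exists>z\<in>carrier K. v (z [^] Suc n) = \<delta> (h b) (h (e 1)))" if "b \<in> univ M" for b
    using ex_difference[of "h b" "h (e 1)" "\<lambda>u. \<exists>z\<in>carrier K. v (z [^] Suc n) = u"] that by simp
  moreover have "sat (valued_field_struct K v) ((\<lambda>n. h (e n))(0 := h b)) (coset_fm n) \<longleftrightarrow>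
      (\<exists>w\<in>carrier K. h b = h (e 1) \<oplus> w \<and> (\<exists>z\<in>carrier K. v (z [^] Suc n) = v w))" for b
  proof -
    let ?N = "valued_field_struct K v" and ?e = "\<lambda>w z. (\<lambda>n. h (e n))(0 := h b, 3 := w, 4 := z)"
    have "tm_val ?N (?e w z) (pow_tm (Var 4) n) = z [^] Suc n" if "z \<in> carrier K" for w z
      using tm_val_pow_tm[of "?e w z" "Var 4" n] that by (simp del: nat_pow_Suc)
    then have "sat ?N (?e w z) (Conj (Divides (Var 3) (pow_tm (Var 4) n)) (Divides (pow_tm (Var 4) n) (Var 3)))
        \<longleftrightarrow> v (z [^] Suc n) = v w" if "z \<in> carrier K" for w z
      using that by (auto simp: valued_field_struct_def simp del: nat_pow_Suc)
    then show ?thesis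
      unfolding coset_fm_def
      by (simp add: valued_field_struct_def cong: bex_cong del: nat_pow_Suc)
  qed
  ultimately show ?thesis
    unfolding elementary_embedding_instance_set[OF assms] by auto
qed

text \<open>
  The subballs of a ball of radius \<open>q L g\<close> with \<open>L = n (l + 2)\<close> are centred at the points
  \<open>c + t\<^bsup>q L + n i + e\<^esup>\<close> for \<open>i \<le> l\<close>, so that the distances between them are congruent to
  \<open>0\<close> modulo \<open>n \<Gamma>\<close> if \<open>e = 0\<close>, and to \<open>g\<close> if \<open>e = 1\<close>.
\<close>

lemma not_convexly_orderable_elementary:
  fixes M :: "'m struct"
  assumes h: "elementary_embedding h M (valued_field_struct K v)"
    and n: "n > 0" and g: "g > 0" "g \<notin> range (nmult n)"
    and t: "t \<in> carrier K" "v t = Fin g" and mem: "\<one> \<in> h ` univ M" "t \<in> h ` univ M"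
  shows "\<not> convexly_orderable M"
proof
  assume "convexly_orderable M"
  then obtain R where R: "linear_order_on (univ M) R"
    and pieces: "\<And>\<phi>. \<exists>k. \<forall>e\<in>assignments M. union_of_convex (univ M) R k (instance_set M \<phi> e)"
    unfolding convexly_orderable_def by blast
  have M: "is_struct M" using h by (simp add: elementary_embedding_def)
  have carr: "h b \<in> carrier K" if "b \<in> univ M" for b
    using h that by (auto simp: elementary_embedding_def valued_field_struct_def)
  have closed: "h a \<oplus> h b \<in> h ` univ M" "h a \<otimes> h b \<in> h ` univ M"
    if ab: "a \<in> univ M" "b \<in> univ M" for a b
  proof -
    have "add_op M a b \<in> univ M" "mul_op M a b \<in> univ M"
      using M ab by (simp_all add: is_struct_def)
    then show "h a \<oplus> h b \<in> h ` univ M" "h a \<otimes> h b \<in> h ` univ M"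
      using elementary_embedding_add[OF h ab, symmetric] elementary_embedding_mul[OF h ab, symmetric]
      by (simp_all add: valued_field_struct_def)
  qed
  have pow: "t [^] m \<in> h ` univ M" for m :: nat
  proof (induction m)
    case (Suc m)
    then obtain a b where "a \<in> univ M" "h a = t [^] m" "b \<in> univ M" "h b = t" using mem(2) by fastforce
    then show ?case using closed(2)[of a b] by simp
  qed (use mem(1) in simp)
  define \<tau> where "\<tau> m = inv_into (univ M) h (t [^] m)" for m :: nat
  have \<tau>: "\<tau> m \<in> univ M" "h (\<tau> m) = t [^] m" for m
    using pow by (simp_all add: \<tau>_def inv_into_into f_inv_into_f)
  \<comment> \<open>The index \<open>n - 1\<close> makes up for the shifted exponent in
    \<open>pow_tm\<close>.\<close>
  obtain k where k: "\<And>e. e \<in> assignments M \<Longrightarrow>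
      union_of_convex (univ M) R k (instance_set M (coset_fm (n - 1)) e)"
    using pieces by blast
  obtain l where l: "\<And>e. e \<in> assignments M \<Longrightarrow>
      union_of_convex (univ M) R l (instance_set M ball_fm e)"
    using pieces by blast
  \<comment> \<open>Being a multiple of \<open>n\<close>, it lets \<open>q * L\<close> copies of
    \<open>g\<close> sum to an element of n\<Gamma>. It exceeds \<open>n * l + 1\<close>, the
    largest exponent added within a level, so balls of the next radius around the new centres are
    disjoint.\<close>
  define L where "L = n * (l + 2)"
  define S where "S a = {b \<in> univ M. \<exists>z\<in>carrier K. v (z [^] n) = \<delta> (h b) (h a)}" for a
  define B where "B c q = {b \<in> univ M. Fin (nmult (q * L) g) \<le> \<delta> (h b) (h c)}" for c q
  have S_conv: "union_of_convex (univ M) R k (S a)" if "a \<in> univ M" for a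
  proof -
    have "(\<lambda>_. a) \<in> assignments M" using that by (simp add: assignments_def)
    from k[OF this] show ?thesis
      using n unfolding instance_set_coset_fm[OF h \<open>(\<lambda>_. a) \<in> assignments M\<close>] S_def by simp
  qed
  have B_conv: "union_of_convex (univ M) R l (B c q)" if "c \<in> univ M" for c q
  proof -
    \<comment> \<open>The radius is the value of \<open>t [^] (q * L)\<close>, a power with the
      preimage \<open>\<tau> (q * L)\<close> in \<open>M\<close>.\<close>
    let ?e = "(\<lambda>_. c)(2 := \<tau> (q * L))"
    have e: "?e \<in> assignments M" using that \<tau> by (simp add: assignments_def)
    from l[OF e] show ?thesis
      unfolding instance_set_ball_fm[OF h e] B_def by (simp add: \<tau> v_pow[OF t])
  qed
  have subballs: "\<exists>d. (\<forall>i\<le>l. d i \<in> univ M \<and> B (d i) (Suc q) \<subseteq> B c q) \<and>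
      (\<forall>i\<le>l. \<forall>j\<le>l. i \<noteq> j \<longrightarrow> B (d i) (Suc q) \<inter> B (d j) (Suc q) = {} \<and>
         (\<forall>a\<in>B (d i) (Suc q). \<forall>b\<in>B (d j) (Suc q). b \<in> S a \<longleftrightarrow> \<epsilon>))" if c: "c \<in> univ M" for c q \<epsilon>
  proof -
    define m where "m i = q * L + n * i + (if \<epsilon> then 0 else 1)" for i
    have m_ge: "q * L \<le> m i" for i by (simp add: m_def)
    have m_less: "m i < Suc q * L" if "i \<le> l" for i
    proof -
      have "n * i \<le> n * l" using that by simp
      moreover have "n * l + 1 < L" using n by (simp add: L_def)
      ultimately have "n * i + 1 < L" by linarith
      then show ?thesis by (simp add: m_def)
    qed
    have m_range: "nmult (min (m i) (m j)) g \<in> range (nmult n) \<longleftrightarrow> \<epsilon>" for i j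
    proof -
      have "min (m i) (m j) = n * (q * (l + 2) + min i j) + (if \<epsilon> then 0 else 1)"
        using n by (simp add: m_def L_def min_def algebra_simps)
      then show ?thesis
        using nmult_Suc_in_range[OF g(2)] by (cases \<epsilon>) (simp_all add: nmult_mult del: sum.lessThan_Suc)
    qed
    have "\<exists>d. \<forall>i. d i \<in> univ M \<and> h (d i) = h c \<oplus> t [^] m i"
    proof (rule choice, rule allI)
      fix i show "\<exists>d. d \<in> univ M \<and> h d = h c \<oplus> t [^] m i"
        using closed(1)[OF c \<tau>(1)[of "m i"]] \<tau>(2) by auto
    qed
    then obtain d where d: "\<And>i. d i \<in> univ M" "\<And>i. h (d i) = h c \<oplus> t [^] m i" by blast
    have dist: "\<delta> (h (d i)) (h (d j)) = Fin (nmult (min (m i) (m j)) g)" if "i \<noteq> j" for i j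
      using \<delta>_powers[OF t g(1) carr[OF c], of "m i" "m j"] n that by (simp add: d m_def)
    have dist_c: "\<delta> (h (d i)) (h c) = Fin (nmult (m i) g)" for i
      using \<delta>_translate[of "t [^] m i" "\<zero>" "h c"] carr[OF c] t
      by (simp add: d \<delta>_zero v_pow)
    have sub: "B (d i) (Suc q) \<subseteq> B c q" if "i \<le> l" for i
    proof
      fix b assume "b \<in> B (d i) (Suc q)"
      then have b: "b \<in> univ M" "Fin (nmult (Suc q * L) g) \<le> \<delta> (h b) (h (d i))"
        by (simp_all add: B_def)
      have "Fin (nmult (q * L) g) \<le> Fin (nmult (Suc q * L) g)"
        using nmult_mono[OF g(1)] by simp
      then have "Fin (nmult (q * L) g) \<le> \<delta> (h b) (h (d i))" using b(2) by (rule order_trans)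
      moreover have "Fin (nmult (q * L) g) \<le> \<delta> (h (d i)) (h c)"
        using nmult_mono[OF g(1) m_ge] by (simp add: dist_c)
      ultimately have "Fin (nmult (q * L) g) \<le> min (\<delta> (h b) (h (d i))) (\<delta> (h (d i)) (h c))"
        by simp
      also have "\<dots> \<le> \<delta> (h b) (h c)"
        by (rule \<delta>_ultrametric[OF carr[OF b(1)] carr[OF d(1)] carr[OF c]])
      finally show "b \<in> B c q" using b by (simp add: B_def)
    qed
    have across: "\<delta> (h b) (h a) = Fin (nmult (min (m i) (m j)) g)"
      if ij: "i \<le> l" "j \<le> l" "i \<noteq> j" and ab: "a \<in> B (d i) (Suc q)" "b \<in> B (d j) (Suc q)" for i j a b
    proof -
      have "nmult (min (m i) (m j)) g < nmult (Suc q * L) g"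
        by (rule nmult_less[OF g(1)]) (use m_less ij in \<open>simp add: min_def\<close>)
      then have less: "\<delta> (h (d i)) (h (d j)) < Fin (nmult (Suc q * L) g)"
        by (simp only: dist[OF ij(3)] less_extended_simps)
      have "\<delta> (h b) (h a) = \<delta> (h (d i)) (h (d j))"
      proof (rule \<delta>_subballs)
        show "h a \<in> carrier K" "h b \<in> carrier K" "h (d i) \<in> carrier K" "h (d j) \<in> carrier K"
          using ab by (simp_all only: B_def mem_Collect_eq carr d(1))
        show "\<delta> (h (d i)) (h (d j)) < \<delta> (h a) (h (d i))"
          by (rule less_le_trans[OF less]) (use ab(1) in \<open>simp only: B_def mem_Collect_eq\<close>)
        show "\<delta> (h (d i)) (h (d j)) < \<delta> (h b) (h (d j))"
          by (rule less_le_trans[OF less]) (use ab(2) in \<open>simp only: B_def mem_Collect_eq\<close>)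
      qed
      then show ?thesis using dist[OF ij(3)] by simp
    qed
    have "B (d i) (Suc q) \<inter> B (d j) (Suc q) = {}" if "i \<le> l" "j \<le> l" "i \<noteq> j" for i j
    proof (rule ccontr)
      assume "B (d i) (Suc q) \<inter> B (d j) (Suc q) \<noteq> {}"
      then obtain x where x: "x \<in> B (d i) (Suc q)" "x \<in> B (d j) (Suc q)" by blast
      then have "\<delta> (h x) (h x) = \<infinity>" using \<delta>_self carr by (simp add: B_def)
      then show False using across[OF that x] by simp
    qed
    moreover have "b \<in> S a \<longleftrightarrow> \<epsilon>"
      if "i \<le> l" "j \<le> l" "i \<noteq> j" "a \<in> B (d i) (Suc q)" "b \<in> B (d j) (Suc q)" for i j a b
      using across[OF that] that(5) m_range[of i j] v_pow_range[OF n] by (simp add: S_def B_def)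
    ultimately show ?thesis using d(1) sub by (intro exI[of _ d]) blast
  qed
  show False
  proof (rule no_alternating_balls[of "univ M" R k S l B])
    show "linear_order_on (univ M) R" by (rule R)
    show "union_of_convex (univ M) R k (S a)" if "a \<in> univ M" for a by (rule S_conv[OF that])
    show "union_of_convex (univ M) R l (B c q)" if "c \<in> univ M" for c q by (rule B_conv[OF that])
    show "\<exists>d. (\<forall>i\<le>l. d i \<in> univ M \<and> B (d i) (Suc q) \<subseteq> B c q) \<and>
      (\<forall>i\<le>l. \<forall>j\<le>l. i \<noteq> j \<longrightarrow> B (d i) (Suc q) \<inter> B (d j) (Suc q) = {} \<and>
         (\<forall>a\<in>B (d i) (Suc q). \<forall>b\<in>B (d j) (Suc q). b \<in> S a \<longleftrightarrow> \<epsilon>))" if "c \<in> univ M" for c q \<epsilon>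
      by (rule subballs[OF that])
    show "univ M \<noteq> {}" using mem by auto
    show "c \<in> B c q" if "c \<in> univ M" for c q
      using \<delta>_self[OF carr[OF that]] that by (simp add: B_def)
  qed
qed

text \<open>With 1 and \<open>t\<close> the substructure has all powers of \<open>t\<close>, from
  which centres and radii are built. Its countability serves the passage from VC-minimality to a
  convex order.\<close>

theorem ex_countable_model_not_convexly_orderable:
  assumes inf: "infinite (UNIV :: 'm set)" and div: "\<not> divisible_group TYPE('g)"
  shows "\<exists>M :: 'm struct. models M (Th (valued_field_struct K v)) \<and> countable (univ M) \<and>
    \<not> convexly_orderable M"
proof -
  obtain n and g :: 'g where n: "n > 0" and g: "g > 0" "g \<notin> range (nmult n)"
    using not_divisible_positive[OF div] .
  obtain t where t: "t \<in> carrier K" "v t = Fin g" using v_onto by blast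
  have "is_struct (valued_field_struct K v)" "countable {\<one>, t}"
    "{\<one>, t} \<subseteq> univ (valued_field_struct K v)"
    using t by (auto simp: is_struct_def valued_field_struct_def)
  from Loewenheim_Skolem[OF inf this] obtain M :: "'m struct" and h where
    h: "elementary_embedding h M (valued_field_struct K v)" and M: "countable (univ M)"
    and mem: "{\<one>, t} \<subseteq> h ` univ M" .
  have "\<not> convexly_orderable M"
    by (rule not_convexly_orderable_elementary[OF h n g t]) (use mem in auto)
  then show ?thesis using elementary_embedding_models[OF h] M by blast
qed

theorem not_convexly_orderable_not_VC_minimal:
  assumes inf: "infinite (UNIV :: 'm set)" and div: "\<not> divisible_group TYPE('g)"
  shows "\<not> convexly_orderable_theory TYPE('m) (Th (valued_field_struct K v))"
    and "\<not> VC_minimal TYPE('m) (Th (valued_field_struct K v))"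
proof -
  obtain M :: "'m struct" where M: "models M (Th (valued_field_struct K v))" "countable (univ M)"
    "\<not> convexly_orderable M"
    using ex_countable_model_not_convexly_orderable[OF assms] by blast
  show "\<not> convexly_orderable_theory TYPE('m) (Th (valued_field_struct K v))"
    using M by (auto simp: convexly_orderable_theory_def)
  show "\<not> VC_minimal TYPE('m) (Th (valued_field_struct K v))"
    using VC_minimal_imp_convexly_orderable[OF inf _ M(1,2)] M(3) by blast
qed

end

section \<open>The field of p-adic numbers\<close>

locale padic =
  fixes p :: nat
  assumes prime: "prime p"
begin

abbreviation w :: "rat \<Rightarrow> int extended" where
  "w \<equiv> rat_padic_val p"

abbreviation mu :: "int \<Rightarrow> nat" where
  "mu \<equiv> multiplicity (int p)"

lemma prime_elem: "prime_elem (int p)"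
  using prime by simp

lemma mu_mult: "a \<noteq> 0 \<Longrightarrow> b \<noteq> 0 \<Longrightarrow> mu (a * b) = mu a + mu b"
  by (rule prime_elem_multiplicity_mult_distrib[OF prime_elem])

lemma w_zero: "w 0 = \<infinity>"
  by (simp add: rat_padic_val_def)

text \<open>The definition uses the fraction given by \<open>quotient_of\<close>;
  cross-multiplication and additivity of the multiplicity give the same difference for any other
  fraction.\<close>

lemma w_divide:
  assumes "a \<noteq> 0" "b \<noteq> 0"
  shows "w (of_int a / of_int b) = Fin (int (mu a) - int (mu b))"
proof -
  define q :: rat where "q = of_int a / of_int b"
  obtain x y where xy: "quotient_of q = (x, y)" by force
  then have y: "y > 0" and q: "q = of_int x / of_int y"
    using quotient_of_denom_pos quotient_of_div by auto
  have "q \<noteq> 0" using assms by (simp add: q_def)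
  then have "x \<noteq> 0" using q by auto
  have "(of_int (a * y) :: rat) = of_int (x * b)"
    using q assms y by (simp add: q_def field_simps)
  then have "a * y = x * b" by (simp only: of_int_eq_iff)
  then have "mu a + mu y = mu x + mu b"
    using mu_mult[of a y] mu_mult[of x b] assms y \<open>x \<noteq> 0\<close> by simp
  then show ?thesis
    using \<open>q \<noteq> 0\<close> xy unfolding q_def[symmetric] rat_padic_val_def by simp
qed

lemma common_denominator:
  fixes q r :: rat
  obtains a b d :: int where "d \<noteq> 0" "q = of_int a / of_int d" "r = of_int b / of_int d"
proof -
  obtain x y x' y' where "quotient_of q = (x, y)" "quotient_of r = (x', y')" by (metis surj_pair)
  then have "y > 0" "q = of_int x / of_int y" "y' > 0" "r = of_int x' / of_int y'"
    using quotient_of_denom_pos quotient_of_div by auto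
  then show ?thesis by (intro that[of "y * y'" "x * y'" "x' * y"]) simp_all
qed

lemma w_infinity: "w q = \<infinity> \<longleftrightarrow> q = 0"
  by (simp add: rat_padic_val_def)

lemma w_not_Minf [simp]: "w q \<noteq> Minf"
  by (simp add: rat_padic_val_def)

lemma w_mult: "w (q * r) = w q + w r"
proof (cases "q = 0 \<or> r = 0")
  case True
  then show ?thesis
    by (cases "w q"; cases "w r") (auto simp: w_zero)
next
  case False
  obtain a b d where d: "d \<noteq> 0" and q: "q = of_int a / of_int d" and r: "r = of_int b / of_int d"
    by (rule common_denominator)
  have ab: "a \<noteq> 0" "b \<noteq> 0" using False q r by auto
  have "q * r = of_int (a * b) / of_int (d * d)" using q r by simp
  then show ?thesis
    using w_divide[of "a * b" "d * d"] w_divide[OF ab(1) d] w_divide[OF ab(2) d] ab d q r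
    by (simp add: mu_mult)
qed

text \<open>Over a common denominator this concerns numerators only: the smaller of the two prime
  powers divides both, hence their sum.\<close>

lemma w_add: "min (w q) (w r) \<le> w (q + r)"
proof (cases "q = 0 \<or> r = 0 \<or> q + r = 0")
  case True
  then show ?thesis by (auto simp: w_zero)
next
  case False
  obtain a b d where d: "d \<noteq> 0" and q: "q = of_int a / of_int d" and r: "r = of_int b / of_int d"
    by (rule common_denominator)
  have sum: "q + r = of_int (a + b) / of_int d" using q r by (simp add: add_divide_distrib)
  have nz: "a \<noteq> 0" "b \<noteq> 0" "a + b \<noteq> 0" using False q r sum by auto
  have "int p ^ min (mu a) (mu b) dvd a + b"
    by (intro dvd_add multiplicity_dvd') auto
  then have "min (mu a) (mu b) \<le> mu (a + b)"
    using nz prime_elem by (intro multiplicity_geI) (auto simp: prime_elem_def)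
  then show ?thesis
    unfolding sum unfolding q r using w_divide[OF nz(1) d] w_divide[OF nz(2) d] w_divide[OF nz(3) d]
    by (simp add: min_def split: if_splits)
qed

lemma w_one: "w 1 = Fin 0"
  using w_divide[of 1 1] by simp

lemma w_uminus: "w (- q) = w q"
proof -
  have "w (- 1) = Fin 0" using w_mult[of "-1" "-1"] w_one w_not_Minf[of "-1"]
    by (cases "w (- 1)") auto
  then show ?thesis using w_mult[of "-1" q] by (cases "w q") auto
qed

lemma w_diff_commute: "w (q - r) = w (r - q)"
  using w_uminus[of "q - r"] by simp

lemma w_add_ge: "k \<le> w q \<Longrightarrow> k \<le> w r \<Longrightarrow> k \<le> w (q + r)"
  using w_add[of q r] by (meson min.boundedI order_trans)

lemma w_diff_ge: "k \<le> w q \<Longrightarrow> k \<le> w r \<Longrightarrow> k \<le> w (q - r)"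
  using w_add_ge[of k q "- r"] by (simp add: w_uminus)

lemma w_mult_ge: "Fin i \<le> w q \<Longrightarrow> Fin j \<le> w r \<Longrightarrow> Fin (i + j) \<le> w (q * r)"
  using add_mono[of "Fin i" "w q" "Fin j" "w r"] by (simp add: w_mult)

text \<open>A small perturbation leaves the value unchanged; this is why the values along a Cauchy
  sequence that is not null stabilize.\<close>

lemma w_eq:
  assumes "w q < w (r - q)"
  shows "w r = w q"
proof -
  have "w q \<le> w r" using w_add_ge[of "w q" q "r - q"] assms by simp
  moreover have "min (w r) (w (r - q)) \<le> w q"
    using w_add[of r "q - r"] w_diff_commute[of q r] by simp
  ultimately show ?thesis using assms by (auto simp: min_def split: if_splits)
qed

lemma w_inverse:
  assumes "w q = Fin c"
  shows "w (inverse q) = Fin (- c)"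
proof -
  have "q \<noteq> 0" using assms w_infinity[of q] by auto
  then have "w q + w (inverse q) = Fin 0" using w_mult[of q "inverse q"] w_one by simp
  then show ?thesis using assms by (cases "w (inverse q)") auto
qed

lemma w_power: "w (of_nat p ^ n) = Fin (int n)"
proof (induction n)
  case (Suc n)
  have "w (of_nat p) = Fin 1"
    using w_divide[of "int p" 1] prime_elem prime by (auto simp: prime_elem_def)
  then show ?case using Suc by (simp add: w_mult)
qed (simp add: w_one)

section \<open>Cauchy sequences and null sequences\<close>

lemma null_iff: "s \<in> padic_null p \<longleftrightarrow> (\<forall>k. \<forall>\<^sub>F n in sequentially. Fin k \<le> w (s n))"
  by (simp add: padic_null_def eventually_sequentially)

lemma CauchyD:
  assumes "s \<in> padic_Cauchy p"
  obtains N where "\<And>m n. m \<ge> N \<Longrightarrow> n \<ge> N \<Longrightarrow> Fin k \<le> w (s m - s n)"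
  using assms unfolding padic_Cauchy_def by blast

lemma CauchyI:
  "(\<And>k. \<exists>N. \<forall>m\<ge>N. \<forall>n\<ge>N. Fin k \<le> w (s m - s n)) \<Longrightarrow> s \<in> padic_Cauchy p"
  by (simp add: padic_Cauchy_def)

lemma Cauchy_bounded:
  assumes "s \<in> padic_Cauchy p"
  obtains B N where "\<And>n. n \<ge> N \<Longrightarrow> Fin B \<le> w (s n)"
proof -
  obtain N where N: "\<And>m n. m \<ge> N \<Longrightarrow> n \<ge> N \<Longrightarrow> Fin 0 \<le> w (s m - s n)"
    using CauchyD[OF assms, of 0] by blast
  obtain B where B: "Fin B \<le> w (s N)" "B \<le> 0"
  proof (cases "w (s N)")
    case (Fin c)
    then show ?thesis using that[of "min c 0"] by simp
  qed (use that[of 0] in auto)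
  have "Fin B \<le> w (s n)" if "n \<ge> N" for n
  proof -
    have "Fin B \<le> w (s n - s N)" using order_trans[OF _ N[OF that order_refl], of "Fin B"] B(2) by simp
    then show ?thesis using w_add_ge[of "Fin B" "s n - s N" "s N"] B(1) by simp
  qed
  then show ?thesis by (rule that)
qed

lemma Cauchy_add:
  assumes "s \<in> padic_Cauchy p" "t \<in> padic_Cauchy p"
  shows "(\<lambda>n. s n + t n) \<in> padic_Cauchy p"
proof (rule CauchyI)
  fix k
  obtain N where N: "\<And>m n. m \<ge> N \<Longrightarrow> n \<ge> N \<Longrightarrow> Fin k \<le> w (s m - s n)"
    using CauchyD[OF assms(1)] by blast
  obtain N' where N': "\<And>m n. m \<ge> N' \<Longrightarrow> n \<ge> N' \<Longrightarrow> Fin k \<le> w (t m - t n)"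
    using CauchyD[OF assms(2)] by blast
  have "Fin k \<le> w ((s m + t m) - (s n + t n))" if "m \<ge> max N N'" "n \<ge> max N N'" for m n
    using w_add_ge[OF N[of m n] N'[of m n]] that by (simp add: algebra_simps)
  then show "\<exists>N. \<forall>m\<ge>N. \<forall>n\<ge>N. Fin k \<le> w ((s m + t m) - (s n + t n))" by blast
qed

lemma Cauchy_const: "(\<lambda>_. c) \<in> padic_Cauchy p"
  by (rule CauchyI) (simp add: w_zero)

lemma Cauchy_mult:
  assumes "s \<in> padic_Cauchy p" "t \<in> padic_Cauchy p"
  shows "(\<lambda>n. s n * t n) \<in> padic_Cauchy p"
proof (rule CauchyI)
  fix k
  obtain B M where B: "\<And>n. n \<ge> M \<Longrightarrow> Fin B \<le> w (s n)"
    using Cauchy_bounded[OF assms(1)] by blast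
  obtain B' M' where B': "\<And>n. n \<ge> M' \<Longrightarrow> Fin B' \<le> w (t n)"
    using Cauchy_bounded[OF assms(2)] by blast
  \<comment> \<open>The precision asked of the differences of one factor makes up for the lower
    bound on the values of the other.\<close>
  obtain N where N: "\<And>m n. m \<ge> N \<Longrightarrow> n \<ge> N \<Longrightarrow> Fin (k - B') \<le> w (s m - s n)"
    using CauchyD[OF assms(1)] by blast
  obtain N' where N': "\<And>m n. m \<ge> N' \<Longrightarrow> n \<ge> N' \<Longrightarrow> Fin (k - B) \<le> w (t m - t n)"
    using CauchyD[OF assms(2)] by blast
  let ?N = "max (max M M') (max N N')"
  have "Fin k \<le> w (s m * t m - s n * t n)" if "m \<ge> ?N" "n \<ge> ?N" for m n
  proof -
    have "Fin k \<le> w (s m * (t m - t n))"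
      using w_mult_ge[OF B[of m] N'[of m n]] that by simp
    moreover have "Fin k \<le> w ((s m - s n) * t n)"
      using w_mult_ge[OF N[of m n] B'[of n]] that by simp
    moreover have "s m * t m - s n * t n = s m * (t m - t n) + (s m - s n) * t n"
      by (simp add: algebra_simps)
    ultimately show ?thesis using w_add_ge by metis
  qed
  then show "\<exists>N. \<forall>m\<ge>N. \<forall>n\<ge>N. Fin k \<le> w (s m * t m - s n * t n)" by blast
qed

lemma Cauchy_uminus: "s \<in> padic_Cauchy p \<Longrightarrow> (\<lambda>n. - s n) \<in> padic_Cauchy p"
  using Cauchy_mult[OF Cauchy_const[of "-1"]] by simp

lemma null_Cauchy:
  assumes "s \<in> padic_null p"
  shows "s \<in> padic_Cauchy p"
proof (rule CauchyI)
  fix k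
  obtain N where "\<And>n. n \<ge> N \<Longrightarrow> Fin k \<le> w (s n)" using assms unfolding padic_null_def by blast
  then show "\<exists>N. \<forall>m\<ge>N. \<forall>n\<ge>N. Fin k \<le> w (s m - s n)" using w_diff_ge by blast
qed

lemma null_add:
  assumes "s \<in> padic_null p" "t \<in> padic_null p"
  shows "(\<lambda>n. s n + t n) \<in> padic_null p"
  unfolding null_iff
proof
  fix k show "\<forall>\<^sub>F n in sequentially. Fin k \<le> w (s n + t n)"
    using assms[unfolded null_iff, rule_format, of k] by eventually_elim (rule w_add_ge)
qed

lemma null_uminus: "s \<in> padic_null p \<Longrightarrow> (\<lambda>n. - s n) \<in> padic_null p"
  by (simp add: null_iff w_uminus)

lemma null_zero: "(\<lambda>_. 0) \<in> padic_null p"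
  by (simp add: null_iff w_zero)

lemma null_mult:
  assumes "s \<in> padic_null p" "t \<in> padic_Cauchy p"
  shows "(\<lambda>n. s n * t n) \<in> padic_null p"
  unfolding null_iff
proof
  fix k
  obtain B N where B: "\<And>n. n \<ge> N \<Longrightarrow> Fin B \<le> w (t n)" using Cauchy_bounded[OF assms(2)] by blast
  have "\<forall>\<^sub>F n in sequentially. Fin (k - B) \<le> w (s n)" using assms(1) by (simp add: null_iff)
  then show "\<forall>\<^sub>F n in sequentially. Fin k \<le> w (s n * t n)"
    using eventually_ge_at_top[of N] by eventually_elim (use w_mult_ge B in fastforce)
qed

text \<open>A sequence that is not null has, arbitrarily late, terms of value below some fixed
  \<open>k\<close>. Once all differences have value at least \<open>k\<close>, one such term fixes
  the value of all the others.\<close>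

lemma eventually_const_val:
  assumes "s \<in> padic_Cauchy p" "s \<notin> padic_null p"
  obtains c where "\<forall>\<^sub>F n in sequentially. w (s n) = Fin c"
proof -
  obtain k where k: "\<And>N. \<exists>n\<ge>N. \<not> Fin k \<le> w (s n)"
    using assms(2) unfolding padic_null_def by blast
  obtain N where N: "\<And>m n. m \<ge> N \<Longrightarrow> n \<ge> N \<Longrightarrow> Fin k \<le> w (s m - s n)"
    using CauchyD[OF assms(1)] by blast
  obtain n where n: "n \<ge> N" "w (s n) < Fin k" using k[of N] by auto
  then obtain c where c: "w (s n) = Fin c" by (cases "w (s n)") auto
  have "w (s m) = Fin c" if "m \<ge> N" for m
    using w_eq[of "s n" "s m"] less_le_trans[OF n(2) N[OF that n(1)]] c by simp
  then show ?thesis using that[of c] by (auto simp: eventually_sequentially)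
qed

lemma Cauchy_inverse:
  assumes "s \<in> padic_Cauchy p" "s \<notin> padic_null p"
  shows "(\<lambda>n. inverse (s n)) \<in> padic_Cauchy p"
proof (rule CauchyI)
  fix k
  obtain c where "\<forall>\<^sub>F n in sequentially. w (s n) = Fin c"
    using eventually_const_val[OF assms] .
  then obtain M where M: "\<And>n. n \<ge> M \<Longrightarrow> w (s n) = Fin c" by (auto simp: eventually_sequentially)
  \<comment> \<open>A difference of inverses is a difference of terms divided by a product of value
    \<open>c + c\<close>.\<close>
  obtain N where N: "\<And>m n. m \<ge> N \<Longrightarrow> n \<ge> N \<Longrightarrow> Fin (k + c + c) \<le> w (s m - s n)"
    using CauchyD[OF assms(1)] by blast
  have "Fin k \<le> w (inverse (s m) - inverse (s n))" if mn: "m \<ge> max M N" "n \<ge> max M N" for m n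
  proof -
    have nz: "s m \<noteq> 0" "s n \<noteq> 0" using M[of m] M[of n] mn w_zero by force+
    have "inverse (s m) - inverse (s n) = (inverse (s m) * inverse (s n)) * (s n - s m)"
      using nz by (simp add: field_simps)
    moreover have "Fin (- c + - c) \<le> w (inverse (s m) * inverse (s n))"
      using w_inverse[OF M[of m]] w_inverse[OF M[of n]] mn by (intro w_mult_ge) auto
    ultimately show ?thesis
      using w_mult_ge[of "- c + - c" "inverse (s m) * inverse (s n)" "k + c + c" "s n - s m"]
        N[of n m] mn by simp
  qed
  then show "\<exists>N. \<forall>m\<ge>N. \<forall>n\<ge>N. Fin k \<le> w (inverse (s m) - inverse (s n))" by blast
qed

text \<open>This makes the description in \<open>padic_val\<close> unique. If one value is a finite
  \<open>c\<close>, the difference eventually has value above \<open>c\<close>, and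
  \<open>w_eq\<close> applies; otherwise both are infinite.\<close>

lemma eventually_val_unique:
  assumes null: "(\<lambda>n. t n - s n) \<in> padic_null p"
    and s: "\<forall>\<^sub>F n in sequentially. w (s n) = a" and t: "\<forall>\<^sub>F n in sequentially. w (t n) = b"
  shows "a = b"
proof -
  have null': "(\<lambda>n. s n - t n) \<in> padic_null p" using null_uminus[OF null] by simp
  have *: "b = a" if null: "(\<lambda>n. t n - s n) \<in> padic_null p" and s: "\<forall>\<^sub>F n in sequentially. w (s n) = a"
    and t: "\<forall>\<^sub>F n in sequentially. w (t n) = b" and a: "a = Fin c" for s t a b c
  proof -
    have "\<forall>\<^sub>F n in sequentially. Fin (c + 1) \<le> w (t n - s n)" using null by (simp add: null_iff)
    with s t have "\<forall>\<^sub>F n in sequentially. b = a"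
    proof eventually_elim
      case (elim n)
      have "w (s n) < w (t n - s n)" using elim a less_le_trans[of "Fin c" "Fin (c + 1)"] by simp
      then show ?case using w_eq[of "s n" "t n"] elim by simp
    qed
    then show ?thesis by simp
  qed
  have notM: "a \<noteq> Minf" if "\<forall>\<^sub>F n in sequentially. w (s n) = a" for s a
    using eventually_happens'[OF _ that] w_not_Minf by force
  show ?thesis
  proof (cases a)
    case (Fin c)
    then show ?thesis using *[OF null s t Fin] by simp
  next
    case Pinf
    show ?thesis
    proof (cases b)
      case (Fin c)
      then show ?thesis using *[OF null' t s Fin] by simp
    qed (use notM[OF t] Pinf in auto)
  qed (use notM[OF s] in auto)
qed

section \<open>The quotient ring and its valuation\<close>

abbreviation R :: "(nat \<Rightarrow> rat) ring" where
  "R \<equiv> padic_Cauchy_ring p"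

lemma R_simps [simp]:
  "carrier R = padic_Cauchy p" "s \<otimes>\<^bsub>R\<^esub> t = (\<lambda>n. s n * t n)" "s \<oplus>\<^bsub>R\<^esub> t = (\<lambda>n. s n + t n)"
  "\<one>\<^bsub>R\<^esub> = (\<lambda>n. 1)" "\<zero>\<^bsub>R\<^esub> = (\<lambda>n. 0)"
  by (simp_all add: padic_Cauchy_ring_def)

lemma cring_R: "cring R"
proof (rule cringI)
  show "abelian_group R"
  proof (rule abelian_groupI)
    fix s assume "s \<in> carrier R"
    then show "\<exists>t\<in>carrier R. t \<oplus>\<^bsub>R\<^esub> s = \<zero>\<^bsub>R\<^esub>"
      by (intro bexI[of _ "\<lambda>n. - s n"]) (auto intro: Cauchy_uminus)
  qed (auto intro: Cauchy_add Cauchy_const simp: algebra_simps)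
  show "comm_monoid R"
    by (rule comm_monoidI) (auto intro: Cauchy_mult Cauchy_const simp: algebra_simps)
qed (auto simp: algebra_simps)

lemma ideal_null: "ideal (padic_null p) R"
proof (rule idealI)
  interpret cring R by (rule cring_R)
  show "ring R" by (rule ring_axioms)
  show "subgroup (padic_null p) (add_monoid R)"
  proof (rule add.subgroupI)
    show "padic_null p \<subseteq> carrier R" using null_Cauchy by auto
    show "padic_null p \<noteq> {}" using null_zero by auto
    show "\<ominus>\<^bsub>R\<^esub> s \<in> padic_null p" if "s \<in> padic_null p" for s
    proof -
      have "\<ominus>\<^bsub>R\<^esub> s = (\<lambda>n. - s n)"
        using that null_Cauchy Cauchy_uminus by (intro minus_equality) auto
      then show ?thesis using null_uminus[OF that] by simp
    qed
    show "s \<oplus>\<^bsub>R\<^esub> t \<in> padic_null p" if "s \<in> padic_null p" "t \<in> padic_null p" for s t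
      using null_add[OF that] by simp
  qed
  show "t \<otimes>\<^bsub>R\<^esub> s \<in> padic_null p" "s \<otimes>\<^bsub>R\<^esub> t \<in> padic_null p"
    if "s \<in> padic_null p" "t \<in> carrier R" for s t
    using null_mult[of s t] that by (simp_all add: mult.commute)
qed

definition cls :: "(nat \<Rightarrow> rat) \<Rightarrow> (nat \<Rightarrow> rat) set" where
  "cls s = padic_null p +>\<^bsub>R\<^esub> s"

lemma mem_cls: "t \<in> cls s \<longleftrightarrow> (\<lambda>n. t n - s n) \<in> padic_null p"
proof
  assume "t \<in> cls s"
  then obtain h where "h \<in> padic_null p" "t = (\<lambda>n. h n + s n)"
    unfolding cls_def a_r_coset_def' by auto
  then show "(\<lambda>n. t n - s n) \<in> padic_null p" by simp
next
  assume "(\<lambda>n. t n - s n) \<in> padic_null p"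
  then show "t \<in> cls s"
    unfolding cls_def a_r_coset_def' by (auto intro!: bexI[of _ "\<lambda>n. t n - s n"])
qed

lemma cls_self: "s \<in> cls s"
  using null_zero by (simp add: mem_cls)

lemma Qp_simps:
  "carrier (Qp p) = cls ` padic_Cauchy p" "\<zero>\<^bsub>Qp p\<^esub> = padic_null p" "\<one>\<^bsub>Qp p\<^esub> = cls (\<lambda>_. 1)"
  by (auto simp: Qp_def FactRing_def A_RCOSETS_def' cls_def)

lemma Qp_add:
  assumes "s \<in> padic_Cauchy p" "t \<in> padic_Cauchy p"
  shows "cls s \<oplus>\<^bsub>Qp p\<^esub> cls t = cls (\<lambda>n. s n + t n)"
proof -
  interpret ideal "padic_null p" R by (rule ideal_null)
  show ?thesis using a_rcos_sum[of s t] assms by (simp add: Qp_def FactRing_def cls_def)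
qed

lemma Qp_mult:
  assumes "s \<in> padic_Cauchy p" "t \<in> padic_Cauchy p"
  shows "cls s \<otimes>\<^bsub>Qp p\<^esub> cls t = cls (\<lambda>n. s n * t n)"
proof -
  interpret ideal "padic_null p" R by (rule ideal_null)
  show ?thesis using rcoset_mult_add[of s t] assms by (simp add: Qp_def FactRing_def cls_def)
qed

lemma cls_eq:
  assumes "(\<lambda>n. t n - s n) \<in> padic_null p"
  shows "cls s = cls t"
proof -
  have "(\<lambda>n. u n - s n) \<in> padic_null p \<longleftrightarrow> (\<lambda>n. u n - t n) \<in> padic_null p" for u
    using null_add[OF _ assms, of "\<lambda>n. u n - t n"] null_add[OF _ null_uminus[OF assms], of "\<lambda>n. u n - s n"]
    by auto
  then show ?thesis by (auto simp: mem_cls)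
qed

lemma cls_eq_zero: "cls s = padic_null p \<longleftrightarrow> s \<in> padic_null p"
proof
  show "cls s = padic_null p \<Longrightarrow> s \<in> padic_null p" using cls_self by blast
  assume "s \<in> padic_null p"
  then have "cls (\<lambda>_. 0) = cls s" by (intro cls_eq) simp
  moreover have "cls (\<lambda>_. 0) = padic_null p" by (auto simp: mem_cls)
  ultimately show "cls s = padic_null p" by simp
qed

lemma padic_val_eqI:
  assumes "t \<in> cls s" "\<forall>\<^sub>F n in sequentially. w (t n) = g"
  shows "padic_val p (cls s) = g"
  unfolding padic_val_def
proof (rule the_equality)
  show "\<exists>s\<in>cls s. \<forall>\<^sub>F n in sequentially. w (s n) = g" using assms by blast
  fix g' assume "\<exists>s\<in>cls s. \<forall>\<^sub>F n in sequentially. w (s n) = g'"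
  then obtain u where u: "u \<in> cls s" "\<forall>\<^sub>F n in sequentially. w (u n) = g'" by blast
  have "(\<lambda>n. t n - u n) \<in> padic_null p"
    using null_add[of "\<lambda>n. t n - s n" "\<lambda>n. - (u n - s n)"] null_uminus[of "\<lambda>n. u n - s n"] assms(1) u(1)
    by (simp add: mem_cls)
  then show "g' = g" by (rule eventually_val_unique[OF _ u(2) assms(2)])
qed

text \<open>In the zero class the constant 0 is taken, since the values along a null sequence need
  not become constant; in any other class \<open>s\<close> itself serves.\<close>

lemma padic_val_attained:
  assumes "s \<in> padic_Cauchy p"
  obtains t where "t \<in> padic_Cauchy p" "cls t = cls s"
    "\<forall>\<^sub>F n in sequentially. w (t n) = padic_val p (cls s)"
proof (cases "s \<in> padic_null p")
  case True
  have mem: "(\<lambda>_. 0) \<in> cls s" using null_uminus[OF True] by (simp add: mem_cls)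
  then have "padic_val p (cls s) = \<infinity>" by (rule padic_val_eqI) (simp add: w_zero)
  moreover have "cls (\<lambda>_. 0) = cls s" using True by (intro cls_eq) simp
  ultimately show ?thesis using Cauchy_const by (intro that[of "\<lambda>_. 0"]) (auto simp: w_zero)
next
  case False
  obtain c where c: "\<forall>\<^sub>F n in sequentially. w (s n) = Fin c"
    using eventually_const_val[OF assms False] .
  then have "padic_val p (cls s) = Fin c" by (rule padic_val_eqI[OF cls_self])
  then show ?thesis using assms c by (intro that[of s]) auto
qed

lemma padic_val_infinity:
  assumes "s \<in> padic_Cauchy p"
  shows "padic_val p (cls s) = \<infinity> \<longleftrightarrow> cls s = padic_null p"
proof
  assume inf: "padic_val p (cls s) = \<infinity>"
  obtain t where t: "cls t = cls s" "\<forall>\<^sub>F n in sequentially. w (t n) = padic_val p (cls s)"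
    using padic_val_attained[OF assms] by blast
  have "t \<in> padic_null p"
    unfolding null_iff using t(2) inf by (auto elim: eventually_mono)
  then show "cls s = padic_null p" using t(1) cls_eq_zero by metis
next
  assume "cls s = padic_null p"
  then have "(\<lambda>_. 0) \<in> cls s" using null_zero by simp
  then show "padic_val p (cls s) = \<infinity>" by (rule padic_val_eqI) (simp add: w_zero)
qed

lemma field_Qp: "field (Qp p)"
proof -
  interpret I: ideal "padic_null p" R by (rule ideal_null)
  interpret Q: cring "Qp p" unfolding Qp_def by (rule I.quotient_is_cring[OF cring_R])
  show ?thesis
  proof (rule Q.cring_fieldI2)
    have "(\<lambda>_. 1) \<notin> padic_null p"
    proof
      assume "(\<lambda>_. 1) \<in> padic_null p"
      then have "\<forall>\<^sub>F n in sequentially. Fin 1 \<le> w 1" unfolding null_iff by blast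
      then show False by (simp add: w_one)
    qed
    then show "\<zero>\<^bsub>Qp p\<^esub> \<noteq> \<one>\<^bsub>Qp p\<^esub>" using cls_self by (auto simp: Qp_simps)
  next
    fix X assume X: "X \<in> carrier (Qp p)" "X \<noteq> \<zero>\<^bsub>Qp p\<^esub>"
    obtain s0 where s0: "s0 \<in> padic_Cauchy p" "X = cls s0"
      using X(1) by (auto simp: Qp_simps(1))
    moreover have "s0 \<notin> padic_null p"
      using X(2) s0(2) cls_eq_zero[of s0] by (simp add: Qp_simps)
    ultimately obtain s where s: "s \<in> padic_Cauchy p" "X = cls s" "s \<notin> padic_null p" by blast
    have inv: "(\<lambda>n. inverse (s n)) \<in> padic_Cauchy p" by (rule Cauchy_inverse[OF s(1,3)])
    obtain c where "\<forall>\<^sub>F n in sequentially. w (s n) = Fin c"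
      using eventually_const_val[OF s(1,3)] .
    \<comment> \<open>Finitely many terms may vanish, and \<open>inverse\<close> sends them to 0, so
      the product is 1 only eventually; the quotient ignores the rest.\<close>
    then have "\<forall>\<^sub>F n in sequentially. 1 - s n * inverse (s n) = 0"
    proof eventually_elim
      case (elim n)
      then have "s n \<noteq> 0" using w_zero by auto
      then show ?case by simp
    qed
    then have "(\<lambda>n. 1 - s n * inverse (s n)) \<in> padic_null p"
      unfolding null_iff by (auto elim!: eventually_mono simp: w_zero)
    then have "cls (\<lambda>n. s n * inverse (s n)) = cls (\<lambda>_. 1)" by (rule cls_eq)
    then show "\<exists>Y\<in>carrier (Qp p). X \<otimes>\<^bsub>Qp p\<^esub> Y = \<one>\<^bsub>Qp p\<^esub>"
      using Qp_mult[OF s(1) inv] inv s(2)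
      by (intro bexI[of _ "cls (\<lambda>n. inverse (s n))"]) (simp_all add: Qp_simps)
  qed
qed

lemma padic_val_mult:
  assumes "s \<in> padic_Cauchy p" "t \<in> padic_Cauchy p"
  shows "padic_val p (cls s \<otimes>\<^bsub>Qp p\<^esub> cls t) = padic_val p (cls s) + padic_val p (cls t)"
proof -
  obtain s' where s': "s' \<in> padic_Cauchy p" "cls s' = cls s"
    "\<forall>\<^sub>F n in sequentially. w (s' n) = padic_val p (cls s)"
    using padic_val_attained[OF assms(1)] .
  obtain t' where t': "t' \<in> padic_Cauchy p" "cls t' = cls t"
    "\<forall>\<^sub>F n in sequentially. w (t' n) = padic_val p (cls t)"
    using padic_val_attained[OF assms(2)] .
  have "\<forall>\<^sub>F n in sequentially. w (s' n * t' n) = padic_val p (cls s) + padic_val p (cls t)"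
    using s'(3) t'(3) by eventually_elim (simp add: w_mult)
  then show ?thesis using padic_val_eqI[OF cls_self] Qp_mult[OF s'(1) t'(1)] s'(2) t'(2) by simp
qed

text \<open>The termwise sum of attaining sequences need not attain the value of its class, hence
  the third sequence \<open>u\<close>. It differs from that sum by a null sequence, so a finite
  value is eventually taken by the sum as well, and \<open>w_add\<close> applies to its
  terms.\<close>

lemma padic_val_add:
  assumes "s \<in> padic_Cauchy p" "t \<in> padic_Cauchy p"
  shows "min (padic_val p (cls s)) (padic_val p (cls t)) \<le> padic_val p (cls s \<oplus>\<^bsub>Qp p\<^esub> cls t)"
proof -
  obtain s' where s': "s' \<in> padic_Cauchy p" "cls s' = cls s"
    "\<forall>\<^sub>F n in sequentially. w (s' n) = padic_val p (cls s)"
    using padic_val_attained[OF assms(1)] .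
  obtain t' where t': "t' \<in> padic_Cauchy p" "cls t' = cls t"
    "\<forall>\<^sub>F n in sequentially. w (t' n) = padic_val p (cls t)"
    using padic_val_attained[OF assms(2)] .
  have sum: "cls s \<oplus>\<^bsub>Qp p\<^esub> cls t = cls (\<lambda>n. s' n + t' n)"
    using Qp_add[OF s'(1) t'(1)] s'(2) t'(2) by simp
  obtain u where u: "cls u = cls (\<lambda>n. s' n + t' n)"
    "\<forall>\<^sub>F n in sequentially. w (u n) = padic_val p (cls (\<lambda>n. s' n + t' n))"
    using padic_val_attained[OF Cauchy_add[OF s'(1) t'(1)]] by blast
  show ?thesis
  proof (cases "padic_val p (cls (\<lambda>n. s' n + t' n))")
    case Pinf
    then show ?thesis by (simp add: sum)
  next
    case Minf
    then show ?thesis using eventually_happens'[OF _ u(2)] w_not_Minf by force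
  next
    case (Fin c)
    have "(\<lambda>n. u n - (s' n + t' n)) \<in> padic_null p" using u(1) cls_self[of u]
      by (simp add: mem_cls)
    then have "\<forall>\<^sub>F n in sequentially. Fin (c + 1) \<le> w (u n - (s' n + t' n))" by (simp add: null_iff)
    with u(2) s'(3) t'(3)
    have "\<forall>\<^sub>F n in sequentially. min (padic_val p (cls s)) (padic_val p (cls t)) \<le> Fin c"
    proof eventually_elim
      case (elim n)
      have "w (u n) < w (s' n + t' n - u n)"
        using elim(1,4) Fin less_le_trans[of "Fin c" "Fin (c + 1)"] w_diff_commute by simp
      then have "w (s' n + t' n) = Fin c" using w_eq[of "u n" "s' n + t' n"] elim(1) Fin by simp
      then show ?case using w_add[of "s' n" "t' n"] elim(2,3) by simp
    qed
    then show ?thesis using Fin by (simp add: sum)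
  qed
qed

lemma padic_val_onto: "\<exists>X\<in>carrier (Qp p). padic_val p X = Fin g"
proof -
  define q :: rat where "q = (if g \<ge> 0 then of_nat p ^ nat g else inverse (of_nat p ^ nat (- g)))"
  have "w q = Fin g"
    using w_power[of "nat g"] w_inverse[OF w_power[of "nat (- g)"]] by (simp add: q_def)
  then have "padic_val p (cls (\<lambda>_. q)) = Fin g" by (intro padic_val_eqI[OF cls_self]) simp
  then show ?thesis using Cauchy_const by (auto simp: Qp_simps)
qed

theorem valued_field_Qp: "valued_field (Qp p) (padic_val p)"
proof -
  interpret field "Qp p" by (rule field_Qp)
  show ?thesis
  proof
    show "\<exists>X\<in>carrier (Qp p). padic_val p X = Fin g" for g by (rule padic_val_onto)
  next
    fix X assume "X \<in> carrier (Qp p)"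
    then obtain s where s: "s \<in> padic_Cauchy p" "X = cls s" by (auto simp: Qp_simps)
    then show "padic_val p X = \<infinity> \<longleftrightarrow> X = \<zero>\<^bsub>Qp p\<^esub>"
      using padic_val_infinity by (simp add: Qp_simps)
    obtain t where "\<forall>\<^sub>F n in sequentially. w (t n) = padic_val p (cls s)"
      using padic_val_attained[OF s(1)] by blast
    then show "padic_val p X \<noteq> Minf"
      using eventually_happens'[of sequentially "\<lambda>n. w (t n) = padic_val p X"] s(2) w_not_Minf by force
  next
    fix X Y assume "X \<in> carrier (Qp p)" "Y \<in> carrier (Qp p)"
    then obtain s t where "s \<in> padic_Cauchy p" "X = cls s" "t \<in> padic_Cauchy p" "Y = cls t"
      by (auto simp: Qp_simps)
    then show "padic_val p (X \<otimes>\<^bsub>Qp p\<^esub> Y) = padic_val p X + padic_val p Y"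
      "min (padic_val p X) (padic_val p Y) \<le> padic_val p (X \<oplus>\<^bsub>Qp p\<^esub> Y)"
      using padic_val_mult padic_val_add by simp_all
  qed
qed

end

lemma not_divisible_int: "\<not> divisible_group TYPE(int)"
proof
  assume "divisible_group TYPE(int)"
  then have "(2::nat) \<ge> 1 \<longrightarrow> range (\<lambda>g :: int. \<Sum>i<(2::nat). g) = UNIV"
    unfolding divisible_group_def by (rule spec)
  then have "range (\<lambda>g :: int. \<Sum>i<(2::nat). g) = UNIV" by (rule mp) simp
  then have "1 \<in> range (\<lambda>g :: int. \<Sum>i<(2::nat). g)" by (simp only: UNIV_I)
  then obtain g :: int where "1 = (\<Sum>i<(2::nat). g)" by (rule rangeE)
  then have "1 = 2 * g" by simp
  then show False by presburger
qed

theorem corollary4p5: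
  fixes K :: "('a, 'b) ring_scheme"
    and v :: "'a \<Rightarrow> 'g::linordered_ab_group_add extended"
  assumes infinite_universe: "infinite (UNIV :: 'm set)"
  shows "(valued_field K v \<and> \<not> divisible_group TYPE('g) \<longrightarrow>
            \<not> convexly_orderable_theory TYPE('m) (Th (valued_field_struct K v)) \<and>
            \<not> VC_minimal TYPE('m) (Th (valued_field_struct K v))) \<and>
         (\<forall>p::nat. prime p \<longrightarrow>
            \<not> VC_minimal TYPE('m) (Th (valued_field_struct (Qp p) (padic_val p))))"
proof (intro conjI impI allI; (elim conjE)?)
  assume "valued_field K v" "\<not> divisible_group TYPE('g)"
  then show "\<not> convexly_orderable_theory TYPE('m) (Th (valued_field_struct K v))"
    "\<not> VC_minimal TYPE('m) (Th (valued_field_struct K v))"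
    using valued_field.not_convexly_orderable_not_VC_minimal[OF _ infinite_universe] by blast+
next
  fix p :: nat assume "prime p"
  then interpret padic p by unfold_locales
  show "\<not> VC_minimal TYPE('m) (Th (valued_field_struct (Qp p) (padic_val p)))"
    by (rule valued_field.not_convexly_orderable_not_VC_minimal(2)
        [OF valued_field_Qp infinite_universe not_divisible_int])
qed

end
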